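(* Let $r:=2$, let $d\ge 2$ be a fixed integer, and put $s^*:=d/2+1$ and $\alpha^*:=1-1/\sqrt{s^*}$. The average-case complexity $E[X]$ of the SVS algorithm is bounded in the following way: $$E[X]\le\tau(d,r,q)\left(\frac{1}{(\alpha^* )^2}\left(\frac{1-\mu_d}{\mu_d}+\frac{1}{(d!)^2\mu_d^2}\right)+\frac{1}{\mu_d}+\left(1-\frac{\mu_d}{\sqrt{s^*}}\right)^{s^*+1}\right)+\mathcal{O}(q^{-1}),$$ where $\tau(d,r,q)$ is the cost of the search in a vertical strip.
   Context: $\mathbb{F}_q$ is the finite field with $q$ elements, and $\mathcal{F}_{r,d}$ (here $r=2$) is the set of all polynomials $F\in\mathbb{F}_q[X_1,\dots,X_r]$ of total degree at most $d$. Put $\mu_d:=\sum_{j=1}^d\frac{(-1)^{j-1}}{j!}$. Let $\mathsf{F}$ be the set of all tuples $\underline{a}=(a_1,\dots,a_{q^{r-1}})$ of pairwise distinct elements of $\mathbb{F}_q^{r-1}$. The SVS ("Search on Vertical Strips") algorithm: on input $F\in\mathcal{F}_{r,d}$ and with random choice $\underline{a}\in\mathsf{F}$, it considers successively $i=1,2,\dots,q^{r-1}$; at step $i$ it searches the vertical strip $\{a_i\}\times\mathbb{F}_q$, that is, it computes $f:=\gcd(F(a_i,X_r),X_r^q-X_r)$ and, if $f\ne 1$, computes a root $x\in\mathbb{F}_q$ of $F(a_i,X_r)$ (a random element of $\mathbb{F}_q$ if $f=0$), outputs $(a_i,x)$ and stops; otherwise it passes to the next $i$. If all strips are exhausted it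 returns "failure". The univariate root-finding routine uses random choices of $r_d$ elements of $\mathbb{F}_q$, for a certain $r_d\in\mathbb{N}$; let $\Omega_d:=\mathbb{F}_q^{r_d}$. $X(\underline{a},F,\omega)$ denotes the number of arithmetic operations in $\mathbb{F}_q$ performed by the algorithm (ignoring the cost of random generation) on input $F$ with choice of strips $\underline{a}\in\mathsf{F}$ and choice $\omega\in\Omega_d$, and $$E[X]:=\frac{1}{|\mathsf{F}|\,|\mathcal{F}_{r,d}|\,|\Omega_d|}\sum_{(\underline{a},F,\omega)\in\mathsf{F}\times\mathcal{F}_{r,d}\times\Omega_d}X(\underline{a},F,\omega).$$ $\tau(d,r,q)$ is the maximum number of arithmetic operations in $\mathbb{F}_q$ necessary to perform a search in one arbitrary vertical strip, which is $\mathcal{O}^{\sim}(D+d\log_2 q)$ with $D:=\binom{d+r}{r}$, where $\mathcal{O}^{\sim}$ ignores logarithmic factors. Thus $X(\underline{a},F,\omega)$ is at most $\tau(d,r,q)$ times the number of vertical strips searched, this number being the least $i$ such that $F(a_i,X_r)$ has a zero in $\mathbb{F}_q$, or $q^{r-1}$ if there is no such $i$. Asymptotic estimates are for fixed $d$ and $q\to\infty$; implied constants may depend on $d$ but not on $q$. *)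

theory Defs
  imports
    "HOL-Algebra.Polynomial_Divisibility"
    "HOL-Number_Theory.Prime_Powers"
    "HOL-Library.Landau_Symbols"
begin

definition mu :: "nat \<Rightarrow> real" where
  "mu d = (\<Sum>j=1..d. (-1) ^ (j - 1) / fact j)"


section \<open>Bivariate polynomials and their restrictions to vertical strips\<close>

text \<open>
  A polynomial of total degree at most \<open>d\<close> in two variables is given by its coefficients:
  \<open>F (i, j)\<close> is the coefficient of \<open>X\<^sub>1\<^sup>i X\<^sub>2\<^sup>j\<close>.
\<close>

definition exponents :: "nat \<Rightarrow> (nat \<times> nat) set" where
  "exponents d = {(i, j). i + j \<le> d}"

definition bipolys :: "('a, 'b) ring_scheme \<Rightarrow> nat \<Rightarrow> (nat \<times> nat \<Rightarrow> 'a) set" where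
  "bipolys K d = exponents d \<rightarrow>\<^sub>E carrier K"

definition strip_coeff ::
    "('a, 'b) ring_scheme \<Rightarrow> nat \<Rightarrow> (nat \<times> nat \<Rightarrow> 'a) \<Rightarrow> 'a \<Rightarrow> nat \<Rightarrow> 'a" where
  "strip_coeff K d F a j = (\<Oplus>\<^bsub>K\<^esub>i\<in>{..d - j}. F (i, j) \<otimes>\<^bsub>K\<^esub> a [^]\<^bsub>K\<^esub> i)"

text \<open>
  The univariate polynomial \<open>F(a, X\<^sub>2)\<close>, as an element of \<^term>\<open>poly_ring K\<close>: a list of
  coefficients starting with the leading one, the zero polynomial being the empty list.
\<close>

definition strip_poly ::
    "('a, 'b) ring_scheme \<Rightarrow> nat \<Rightarrow> (nat \<times> nat \<Rightarrow> 'a) \<Rightarrow> 'a \<Rightarrow> 'a list" where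
  "strip_poly K d F a = ring.normalize K (map (strip_coeff K d F a) (rev [0..<d + 1]))"

text \<open>
  The polynomial \<open>f = gcd(F(a, X\<^sub>2), X\<^sub>2\<^sup>q - X\<^sub>2)\<close> computed in a vertical strip, normalized to be
  monic. If \<open>F(a, X\<^sub>2) = 0\<close>, the algorithm takes \<open>f = 0\<close> (literally, the gcd would be
  \<open>X\<^sub>2\<^sup>q - X\<^sub>2\<close>, which has the same roots and also differs from 1).
\<close>

definition strip_gcd ::
    "('a, 'b) ring_scheme \<Rightarrow> nat \<Rightarrow> (nat \<times> nat \<Rightarrow> 'a) \<Rightarrow> 'a \<Rightarrow> 'a list" where
  "strip_gcd K d F a =
    (if strip_poly K d F a = [] then []
     else THE f. f \<in> carrier (poly_ring K) \<and> f \<noteq> [] \<and> lead_coeff f = \<one>\<^bsub>K\<^esub> \<and>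
       f gcdof\<^bsub>poly_ring K\<^esub> (strip_poly K d F a)
         (X\<^bsub>K\<^esub> [^]\<^bsub>poly_ring K\<^esub> card (carrier K) \<ominus>\<^bsub>poly_ring K\<^esub> X\<^bsub>K\<^esub>))"


section \<open>Arithmetic operations\<close>

text \<open>
  Routines are algebraic computation trees over \<open>K\<close>. They act on a growing list of registers,
  which initially holds the input. Each of \<open>+\<close>, \<open>-\<close>, \<open>*\<close>, \<open>/\<close> costs one arithmetic operation and
  appends its result; loading a constant, testing a register for zero and returning a list of
  registers are not arithmetic operations. Division by zero and a nonexistent register both
  give zero.
\<close>

datatype arith_op = Add | Sub | Mul | Div

datatype (tree_consts: 'a) tree =
    Return "nat list"
  | Load 'a "'a tree"
  | Arith arith_op nat nat "'a tree"
  | If_Zero nat "'a tree" "'a tree"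

fun arith :: "('a, 'b) ring_scheme \<Rightarrow> arith_op \<Rightarrow> 'a \<Rightarrow> 'a \<Rightarrow> 'a" where
  "arith K Add x y = x \<oplus>\<^bsub>K\<^esub> y"
| "arith K Sub x y = x \<ominus>\<^bsub>K\<^esub> y"
| "arith K Mul x y = x \<otimes>\<^bsub>K\<^esub> y"
| "arith K Div x y = (if y = \<zero>\<^bsub>K\<^esub> then \<zero>\<^bsub>K\<^esub> else x \<otimes>\<^bsub>K\<^esub> inv\<^bsub>K\<^esub> y)"

definition reg :: "('a, 'b) ring_scheme \<Rightarrow> 'a list \<Rightarrow> nat \<Rightarrow> 'a" where
  "reg K rs i = (if i < length rs then rs ! i else \<zero>\<^bsub>K\<^esub>)"

fun run :: "('a, 'b) ring_scheme \<Rightarrow> 'a tree \<Rightarrow> 'a list \<Rightarrow> 'a list" where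
  "run K (Return is) rs = map (reg K rs) is"
| "run K (Load c t) rs = run K t (rs @ [c])"
| "run K (Arith b i j t) rs = run K t (rs @ [arith K b (reg K rs i) (reg K rs j)])"
| "run K (If_Zero i t u) rs = (if reg K rs i = \<zero>\<^bsub>K\<^esub> then run K t rs else run K u rs)"

fun ops :: "('a, 'b) ring_scheme \<Rightarrow> 'a tree \<Rightarrow> 'a list \<Rightarrow> nat" where
  "ops K (Return is) rs = 0"
| "ops K (Load c t) rs = ops K t (rs @ [c])"
| "ops K (Arith b i j t) rs = 1 + ops K t (rs @ [arith K b (reg K rs i) (reg K rs j)])"
| "ops K (If_Zero i t u) rs = (if reg K rs i = \<zero>\<^bsub>K\<^esub> then ops K t rs else ops K u rs)"


section \<open>The algorithm SVS\<close>

text \<open>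
  The search in a strip uses two routines. The first one, \<open>G\<close>, receives \<open>a\<close> and the coefficients
  of \<open>F\<close> and computes \<open>f\<close>. The second one, \<open>R\<close>, is called only if \<open>f \<noteq> 1\<close>; it receives the
  coefficients of \<open>f\<close> (from degree 0 to degree \<open>d\<close>) and the random elements \<open>\<omega>\<close>, and computes
  a root of \<open>F(a, X\<^sub>2)\<close>; for \<open>f = 0\<close> every element of \<open>K\<close> is admissible.
\<close>

definition gcd_input :: "nat \<Rightarrow> (nat \<times> nat \<Rightarrow> 'a) \<Rightarrow> 'a \<Rightarrow> 'a list" where
  "gcd_input d F a = a # [F (i, j). i \<leftarrow> [0..<d + 1], j \<leftarrow> [0..<d + 1 - i]]"

definition root_input :: "('a, 'b) ring_scheme \<Rightarrow> nat \<Rightarrow> 'a list \<Rightarrow> 'a list \<Rightarrow> 'a list" where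
  "root_input K d f \<omega> = map (ring.coeff K f) [0..<d + 1] @ \<omega>"

definition random_choices :: "('a, 'b) ring_scheme \<Rightarrow> nat \<Rightarrow> 'a list set" where
  "random_choices K m = {\<omega>. set \<omega> \<subseteq> carrier K \<and> length \<omega> = m}"

definition gcd_routine :: "('a, 'b) ring_scheme \<Rightarrow> nat \<Rightarrow> 'a tree \<Rightarrow> bool" where
  "gcd_routine K d G \<longleftrightarrow> tree_consts G \<subseteq> carrier K \<and>
    (\<forall>F\<in>bipolys K d. \<forall>a\<in>carrier K. run K G (gcd_input d F a) = strip_gcd K d F a)"

definition root_routine :: "('a, 'b) ring_scheme \<Rightarrow> nat \<Rightarrow> nat \<Rightarrow> 'a tree \<Rightarrow> bool" where
  "root_routine K d m R \<longleftrightarrow> tree_consts R \<subseteq> carrier K \<and>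
    (\<forall>F\<in>bipolys K d. \<forall>a\<in>carrier K. \<forall>\<omega>\<in>random_choices K m.
       strip_gcd K d F a \<noteq> [\<one>\<^bsub>K\<^esub>] \<longrightarrow>
       (\<exists>x\<in>carrier K. run K R (root_input K d (strip_gcd K d F a) \<omega>) = [x] \<and>
          ring.eval K (strip_poly K d F a) x = \<zero>\<^bsub>K\<^esub>))"

text \<open>The result of a search in one strip (\<^term>\<open>None\<close> if \<open>f = 1\<close>), and its cost.\<close>

definition strip_search ::
    "('a, 'b) ring_scheme \<Rightarrow> nat \<Rightarrow> 'a tree \<Rightarrow> 'a tree \<Rightarrow>
     (nat \<times> nat \<Rightarrow> 'a) \<Rightarrow> 'a list \<Rightarrow> 'a \<Rightarrow> 'a option \<times> nat" where
  "strip_search K d G R F \<omega> a =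
    (let f = run K G (gcd_input d F a); c = ops K G (gcd_input d F a)
     in if f = [\<one>\<^bsub>K\<^esub>] then (None, c)
        else (Some (hd (run K R (root_input K d f \<omega>))), c + ops K R (root_input K d f \<omega>)))"

text \<open>
  The output of SVS on the strips still to be searched (\<^term>\<open>None\<close> meaning failure) and the
  number of arithmetic operations performed.
\<close>

fun svs ::
    "('a, 'b) ring_scheme \<Rightarrow> nat \<Rightarrow> 'a tree \<Rightarrow> 'a tree \<Rightarrow>
     (nat \<times> nat \<Rightarrow> 'a) \<Rightarrow> 'a list \<Rightarrow> 'a list \<Rightarrow> ('a \<times> 'a) option \<times> nat" where
  "svs K d G R F \<omega> [] = (None, 0)"
| "svs K d G R F \<omega> (a # as) =
    (case strip_search K d G R F \<omega> a of
       (Some x, c) \<Rightarrow> (Some (a, x), c)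
     | (None, c) \<Rightarrow> (let (res, c') = svs K d G R F \<omega> as in (res, c + c')))"

definition strips :: "('a, 'b) ring_scheme \<Rightarrow> 'a list set" where
  "strips K = {as. set as \<subseteq> carrier K \<and> distinct as \<and> length as = card (carrier K)}"

definition svs_cost ::
    "('a, 'b) ring_scheme \<Rightarrow> nat \<Rightarrow> 'a tree \<Rightarrow> 'a tree \<Rightarrow>
     'a list \<Rightarrow> (nat \<times> nat \<Rightarrow> 'a) \<Rightarrow> 'a list \<Rightarrow> nat" where
  "svs_cost K d G R as F \<omega> = snd (svs K d G R F \<omega> as)"

definition average_cost ::
    "('a, 'b) ring_scheme \<Rightarrow> nat \<Rightarrow> nat \<Rightarrow> 'a tree \<Rightarrow> 'a tree \<Rightarrow> real" where
  "average_cost K d m G R =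
    1 / (real (card (strips K)) * real (card (bipolys K d)) * real (card (random_choices K m))) *
    (\<Sum>(as, F, \<omega>) \<in> strips K \<times> bipolys K d \<times> random_choices K m.
       real (svs_cost K d G R as F \<omega>))"

definition strip_cost ::
    "('a, 'b) ring_scheme \<Rightarrow> nat \<Rightarrow> nat \<Rightarrow> 'a tree \<Rightarrow> 'a tree \<Rightarrow> nat" where
  "strip_cost K d m G R =
    Max ((\<lambda>(a, F, \<omega>). snd (strip_search K d G R F \<omega> a)) `
      (carrier K \<times> bipolys K d \<times> random_choices K m))"

end

theory Submission
  imports Defs "HOL-Combinatorics.Multiset_Permutations"
begin

text \<open>
  Fix the coefficient \<open>c\<close> of \<open>X\<^sub>2\<^sup>d\<close>. As all the other coefficients of \<open>F(a, X\<^sub>2)\<close> are values at \<open>a\<close>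
  of polynomials that are allowed to have degree 1, the restrictions of \<open>F\<close> to two different strips
  are independent and uniformly distributed. So the number \<open>N\<close> of strips with a root has mean \<open>p q\<close>
  and variance \<open>p (1 - p) q\<close>, where \<open>p\<close> is the probability that \<open>c X\<^sup>d + \<dots>\<close> has a root. For given
  \<open>F\<close>, the mean number of strips searched is at most \<open>(q + 1) / (N + 1)\<close>, and the mean of this over
  \<open>F\<close> is at most \<open>1 / p + (1 - p) / p\<close>. For \<open>c \<noteq> 0\<close>, inclusion-exclusion gives \<open>p\<close> exactly, and
  \<open>p \<longlonglongrightarrow> \<mu>\<^sub>d\<close>; the case \<open>c = 0\<close> has probability \<open>1 / q\<close> and only needs \<open>p \<ge> 1 / 2\<close>. Hence the mean
  number of strips searched is at most \<open>1 / \<mu>\<^sub>d + (1 - \<mu>\<^sub>d) / \<mu>\<^sub>d + o(1)\<close>. The main term is strictly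
  smaller than the claimed one, so the error term of the theorem only has to absorb finitely many \<open>q\<close>.
\<close>

section \<open>Monic greatest common divisors\<close>

text \<open>Gives the definite description in \<open>strip_gcd\<close> a meaning. The polynomial
  ring is principal, and the gcds of \<open>p\<close> and \<open>b\<close> are exactly the
  generators of the ideal sum \<open>I\<close>; as \<open>I\<close> contains \<open>p\<close>, it is
  nonzero and has a single monic generator.\<close>

lemma (in field) ex1_monic_gcd:
  assumes p: "p \<in> carrier (poly_ring R)" "p \<noteq> []" and b: "b \<in> carrier (poly_ring R)"
  shows "\<exists>!f. f \<in> carrier (poly_ring R) \<and> f \<noteq> [] \<and> lead_coeff f = \<one> \<and> f gcdof\<^bsub>poly_ring R\<^esub> p b"
proof -
  interpret UP: principal_domain "poly_ring R"
    using univ_poly_is_principal[OF carrier_is_subfield] .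
  define I where "I = PIdl\<^bsub>poly_ring R\<^esub> p <+>\<^bsub>poly_ring R\<^esub> PIdl\<^bsub>poly_ring R\<^esub> b"
  have I: "ideal I (poly_ring R)"
    unfolding I_def using p b by (intro UP.add_ideals UP.cgenideal_ideal)
  have "p \<in> I"
  proof -
    have "p = p \<oplus>\<^bsub>poly_ring R\<^esub> \<zero>\<^bsub>poly_ring R\<^esub>"
      using p by simp
    moreover have "p \<in> PIdl\<^bsub>poly_ring R\<^esub> p" "\<zero>\<^bsub>poly_ring R\<^esub> \<in> PIdl\<^bsub>poly_ring R\<^esub> b"
      using p b UP.cgenideal_self UP.cgenideal_ideal additive_subgroup.zero_closed ideal.axioms(1)
      by metis+
    ultimately show ?thesis
      unfolding I_def set_add_def' by blast
  qed
  with p(2) have "I \<noteq> {[]}" by blast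
  from exists_unique_gen[OF carrier_is_subfield I this]
  have ex1: "\<exists>!f. f \<in> carrier (poly_ring R) \<and> lead_coeff f = \<one> \<and> I = PIdl\<^bsub>poly_ring R\<^esub> f" .
  have iff: "f gcdof\<^bsub>poly_ring R\<^esub> p b \<longleftrightarrow> I = PIdl\<^bsub>poly_ring R\<^esub> f" if "f \<in> carrier (poly_ring R)" for f
    using UP.ideal_sum_iff_gcd[OF p(1) b that] unfolding I_def by auto
  \<comment> \<open>\<open>lead_coeff []\<close> is unspecified, so being monic does not exclude
    \<open>f = []\<close>; instead, zero cannot divide the nonzero \<open>p\<close>.\<close>
  have "f \<noteq> []" if "f gcdof\<^bsub>poly_ring R\<^esub> p b" "f \<in> carrier (poly_ring R)" for f
  proof
    assume "f = []"
    with that have "\<zero>\<^bsub>poly_ring R\<^esub> divides\<^bsub>poly_ring R\<^esub> p"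
      by (simp add: isgcd_def univ_poly_zero)
    thus False
      using p UP.zero_divides by (simp add: univ_poly_zero)
  qed
  with ex1 iff show ?thesis by (smt (verit))
qed

lemma (in field) pow_card_eq_self:
  assumes "finite (carrier R)" "x \<in> carrier R"
  shows "x [^] card (carrier R) = x"
proof (cases "x = \<zero>")
  case True
  obtain n where "card (carrier R) = Suc n" using assms by (cases "card (carrier R)") auto
  thus ?thesis using True by simp
next
  case False
  interpret U: group "units_of R" by (rule units_group)
  have "x \<in> Units R" using False assms field_Units by simp
  hence "x [^] order (units_of R) = \<one>"
    using U.pow_order_eq_1[of x] by (simp add: units_of_carrier units_of_pow units_of_one)
  moreover obtain n where n: "card (carrier R) = Suc n" using assms by (cases "card (carrier R)") auto
  moreover have "order (units_of R) = n"
    using n field_Units assms by (simp add: order_def units_of_carrier)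
  ultimately show ?thesis using assms by simp
qed

lemma (in ring) strip_poly_carrier:
  assumes "set (map (strip_coeff R d F a) (rev [0..<d + 1])) \<subseteq> carrier R"
  shows "strip_poly R d F a \<in> carrier (poly_ring R)"
  unfolding strip_poly_def univ_poly_carrier[symmetric]
  by (rule normalize_gives_polynomial[OF assms])

text \<open>A root \<open>x\<close> makes X - x a common divisor of F(a, X) and X^q - X, hence a
  divisor of their gcd, whereas X - x does not divide 1. So a search stops at the latest in the
  first strip with a root, which is the direction that an upper bound for the cost requires.\<close>

lemma (in field) strip_gcd_neq_one_if_root:
  assumes fin: "finite (carrier R)" and p: "strip_poly R d F a \<in> carrier (poly_ring R)"
    and x: "x \<in> carrier R" "eval (strip_poly R d F a) x = \<zero>"
  shows "strip_gcd R d F a \<noteq> [\<one>]"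
proof (cases "strip_poly R d F a = []")
  case True
  thus ?thesis by (simp add: strip_gcd_def)
next
  case False
  interpret UP: domain "poly_ring R"
    using univ_poly_is_domain[OF carrier_is_subring] .
  let ?b = "X [^]\<^bsub>poly_ring R\<^esub> card (carrier R) \<ominus>\<^bsub>poly_ring R\<^esub> X"
  let ?l = "[\<one>, \<ominus> x]"
  have Xc: "X \<in> carrier (poly_ring R)" using var_closed(1)[OF carrier_is_subring] .
  hence b: "?b \<in> carrier (poly_ring R)" by simp
  let ?f = "strip_gcd R d F a"
  have f: "?f gcdof\<^bsub>poly_ring R\<^esub> strip_poly R d F a ?b"
    using theI'[OF ex1_monic_gcd[OF p False b]] False unfolding strip_gcd_def by auto
  interpret E: ring_hom_ring "poly_ring R" R "\<lambda>p. eval p x"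
    using eval_ring_hom[OF carrier_is_subring x(1)] .
  have "eval ?b x = x [^] card (carrier R) \<ominus> x"
    using Xc x(1) by (simp add: a_minus_def E.hom_nat_pow eval_var)
  also have "\<dots> = \<zero>" using pow_card_eq_self[OF fin x(1)] x(1) by simp
  finally have "eval ?b x = \<zero>" .
  have l: "?l \<in> carrier (poly_ring R)"
    using x(1) unfolding univ_poly_carrier[symmetric] by (simp add: polynomial_def)
  have dvd: "?l divides\<^bsub>poly_ring R\<^esub> q" if "q \<in> carrier (poly_ring R)" "eval q x = \<zero>" for q
  \<comment> \<open>\<open>is_root\<close> excludes the zero polynomial, which every polynomial
    divides.\<close>
  proof (cases "q = []")
    case True
    thus ?thesis using l UP.divides_zero by (simp add: univ_poly_zero)
  next
    case False
    thus ?thesis using is_root_imp_pdivides[OF that(1)] that x(1)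
      by (simp add: is_root_def pdivides_def)
  qed
  have "?l divides\<^bsub>poly_ring R\<^esub> ?f"
    using f dvd[OF p x(2)] dvd[OF b \<open>eval ?b x = \<zero>\<close>] l unfolding isgcd_def by blast
  moreover have "\<not> ?l divides\<^bsub>poly_ring R\<^esub> [\<one>]"
  proof
    assume "?l divides\<^bsub>poly_ring R\<^esub> [\<one>]"
    moreover have "eval ?l x = \<zero>" using x(1) by (simp add: r_neg)
    ultimately have "eval [\<one>] x = \<zero>"
      using pdivides_imp_root_sharing[OF l _ x(1)] unfolding pdivides_def by blast
    thus False using x(1) by simp
  qed
  ultimately show ?thesis by auto
qed

section \<open>Univariate polynomials with a prescribed leading coefficient\<close>

text \<open>The coefficients after the first one of \<open>(X - s) (c X\<^sup>n + q\<^sub>1 X\<^sup>n\<^sup>-\<^sup>1 + \<dots>)\<close>.\<close>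

fun linear_mult :: "('a, 'b) ring_scheme \<Rightarrow> 'a \<Rightarrow> 'a \<Rightarrow> 'a list \<Rightarrow> 'a list" where
  "linear_mult K s c [] = [\<ominus>\<^bsub>K\<^esub> (s \<otimes>\<^bsub>K\<^esub> c)]"
| "linear_mult K s c (q # qs) = (q \<ominus>\<^bsub>K\<^esub> s \<otimes>\<^bsub>K\<^esub> c) # linear_mult K s q qs"

lemma length_linear_mult [simp]: "length (linear_mult K s c qs) = Suc (length qs)"
  by (induction qs arbitrary: c) auto

context field
begin

lemma linear_mult_carrier:
  assumes "s \<in> carrier R" "c \<in> carrier R" "set qs \<subseteq> carrier R"
  shows "set (linear_mult R s c qs) \<subseteq> carrier R"
  using assms by (induction qs arbitrary: c) auto

text \<open>Induction along the list: the two terms that contain \<open>c\<close> add up to (x - s)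
  times the leading term, and what remains is again a \<open>linear_mult\<close>, now with leading
  coefficient \<open>q\<close>.\<close>

lemma eval_linear_mult:
  assumes "s \<in> carrier R" "c \<in> carrier R" "set qs \<subseteq> carrier R" "x \<in> carrier R"
  shows "eval (c # linear_mult R s c qs) x = (x \<ominus> s) \<otimes> eval (c # qs) x"
  using assms
proof (induction qs arbitrary: c)
  case Nil
  thus ?case by (simp; algebra)
next
  case (Cons q qs)
  let ?n = "length qs" and ?e = "eval qs x" and ?L = "linear_mult R s q qs"
  have carr: "q \<in> carrier R" "eval qs x \<in> carrier R" "x [^] ?n \<in> carrier R"
      "eval ?L x \<in> carrier R"
    using Cons.prems linear_mult_carrier[of s q qs] by (auto intro: eval_in_carrier)
  have IH: "q \<otimes> (x [^] ?n \<otimes> x) \<oplus> eval ?L x = (x \<ominus> s) \<otimes> (q \<otimes> x [^] ?n \<oplus> ?e)"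
    using Cons.IH[of q] Cons.prems by simp
  have "eval (c # linear_mult R s c (q # qs)) x
      = c \<otimes> (x [^] ?n \<otimes> x \<otimes> x) \<oplus> ((q \<ominus> s \<otimes> c) \<otimes> (x [^] ?n \<otimes> x) \<oplus> eval ?L x)"
    by simp
  also have "\<dots> = c \<otimes> (x [^] ?n \<otimes> x \<otimes> x) \<ominus> s \<otimes> c \<otimes> (x [^] ?n \<otimes> x)
      \<oplus> (q \<otimes> (x [^] ?n \<otimes> x) \<oplus> eval ?L x)"
    using Cons.prems carr by (simp; algebra)
  also have "\<dots> = (x \<ominus> s) \<otimes> eval (c # q # qs) x"
    unfolding IH using Cons.prems carr by (simp; algebra)
  finally show ?case .
qed

lemma linear_mult_inj:
  assumes "s \<in> carrier R" "c \<in> carrier R" "set qs \<subseteq> carrier R" "set qs' \<subseteq> carrier R"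
    "linear_mult R s c qs = linear_mult R s c qs'"
  shows "qs = qs'"
  using assms
proof (induction qs arbitrary: c qs')
  case Nil
  from arg_cong[OF Nil(5), of length] have "length qs' = 0" by simp
  thus ?case by simp
next
  case (Cons q qs)
  from arg_cong[OF Cons(6), of length] obtain q' ps where qs': "qs' = q' # ps"
    by (cases qs') auto
  with Cons.prems have "q \<ominus> s \<otimes> c = q' \<ominus> s \<otimes> c" by simp
  hence "q = q'" using Cons.prems qs' by (simp add: a_minus_def)
  with Cons qs' show ?case by auto
qed

text \<open>The factor theorem by synthetic division. On lists with a prescribed first entry it also
  makes sense for \<open>c = \<zero>\<close>, a case that occurs when F has no X2^d term.\<close>

lemma ex_linear_mult:
  assumes "s \<in> carrier R" "c \<in> carrier R" "set ps \<subseteq> carrier R" "length ps = Suc n"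
    "eval (c # ps) s = \<zero>"
  shows "\<exists>qs. set qs \<subseteq> carrier R \<and> length qs = n \<and> ps = linear_mult R s c qs"
  using assms
proof (induction n arbitrary: c ps)
  case 0
  then obtain p where ps: "ps = [p]" by (cases ps) auto
  with 0 have p: "p \<in> carrier R" "c \<otimes> s \<oplus> p = \<zero>" by auto
  hence "p = \<ominus> (s \<otimes> c)" using 0 by (metis add.inv_equality m_closed m_comm minus_minus add.m_comm)
  thus ?case using ps by (intro exI[of _ "[]"]) simp
next
  case (Suc n)
  then obtain p ps' where ps: "ps = p # ps'" and l: "length ps' = Suc n"
    by (cases ps) auto
  \<comment> \<open>The second quotient coefficient in Horner's scheme.\<close>
  define q where "q = p \<oplus> s \<otimes> c"
  have carr: "p \<in> carrier R" "set ps' \<subseteq> carrier R" "q \<in> carrier R" "s [^] length ps' \<in> carrier R"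
     "eval ps' s \<in> carrier R"
    using Suc.prems ps unfolding q_def by (auto intro: eval_in_carrier)
  have "c \<otimes> (s [^] length ps' \<otimes> s) \<oplus> (p \<otimes> s [^] length ps' \<oplus> eval ps' s) = \<zero>"
    using Suc.prems ps by simp
  hence "q \<otimes> s [^] length ps' \<oplus> eval ps' s = \<zero>"
    unfolding q_def using carr Suc.prems by algebra
  then obtain qs where qs: "set qs \<subseteq> carrier R" "length qs = n" "ps' = linear_mult R s q qs"
    using Suc.IH[of q ps'] Suc.prems carr l by auto
  have "p = q \<ominus> s \<otimes> c" unfolding q_def using carr Suc.prems by algebra
  thus ?case using qs ps carr by (intro exI[of _ "q # qs"]) auto
qed

text \<open>Multiplication by X - s is a bijection from \<open>?B\<close> to \<open>?A\<close>.
  Since \<open>s \<notin> S\<close> and there are no zero divisors, the product vanishes on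
  \<open>S\<close> exactly when the other factor does.\<close>

lemma card_vanishing_insert:
  assumes "s \<in> carrier R" "c \<in> carrier R" "S \<subseteq> carrier R" "s \<notin> S"
  shows "card {ps \<in> random_choices R (Suc n). \<forall>x\<in>insert s S. eval (c # ps) x = \<zero>}
       = card {ps \<in> random_choices R n. \<forall>x\<in>S. eval (c # ps) x = \<zero>}" (is "card ?A = card ?B")
proof -
  have zero_iff: "eval (c # linear_mult R s c qs) x = \<zero> \<longleftrightarrow> x = s \<or> eval (c # qs) x = \<zero>"
    if "set qs \<subseteq> carrier R" "x \<in> carrier R" for qs x
  proof -
    have "eval (c # qs) x \<in> carrier R" using that assms by (intro eval_in_carrier) auto
    thus ?thesis using that assms
      by (simp add: eval_linear_mult[OF assms(1,2) that] integral_iff r_right_minus_eq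
               del: eval.simps)
  qed
  have "bij_betw (linear_mult R s c) ?B ?A"
    unfolding bij_betw_def
  proof
    show "inj_on (linear_mult R s c) ?B"
      using linear_mult_inj[OF assms(1,2)] by (auto simp: inj_on_def random_choices_def)
    show "linear_mult R s c ` ?B = ?A"
    proof
      show "linear_mult R s c ` ?B \<subseteq> ?A"
      proof
        fix ps assume "ps \<in> linear_mult R s c ` ?B"
        then obtain qs where qs: "qs \<in> ?B" "ps = linear_mult R s c qs" by blast
        hence "set ps \<subseteq> carrier R" "length ps = Suc n"
          using linear_mult_carrier[OF assms(1,2)] by (auto simp: random_choices_def)
        moreover have "eval (c # ps) x = \<zero>" if "x \<in> insert s S" for x
          using zero_iff[of qs x] qs that assms
          by (auto simp: random_choices_def simp del: eval.simps)
        ultimately show "ps \<in> ?A" by (simp add: random_choices_def del: eval.simps)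
      qed
      show "?A \<subseteq> linear_mult R s c ` ?B"
      proof
        fix ps assume ps: "ps \<in> ?A"
        then obtain qs where qs: "set qs \<subseteq> carrier R" "length qs = n" "ps = linear_mult R s c qs"
          using ex_linear_mult[OF assms(1,2), of ps n]
          by (auto simp: random_choices_def simp del: eval.simps)
        moreover have "eval (c # qs) x = \<zero>" if "x \<in> S" for x
          using zero_iff[of qs x] qs that assms ps
          by (auto simp: random_choices_def simp del: eval.simps)
        ultimately show "ps \<in> linear_mult R s c ` ?B"
          by (auto simp: random_choices_def simp del: eval.simps)
      qed
    qed
  qed
  from bij_betw_same_card[OF this] show ?thesis by (rule sym)
qed

lemma card_random_choices:
  "finite (carrier R) \<Longrightarrow> card (random_choices R n) = card (carrier R) ^ n"
  unfolding random_choices_def using card_lists_length_eq by blast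

text \<open>Each prescribed root uses up one free coefficient. When there are more points than free
  coefficients the count is 0 only for \<open>c \<noteq> \<zero>\<close>, since the zero polynomial
  vanishes everywhere; hence the hypothesis \<open>nz\<close>.\<close>

lemma card_vanishing:
  assumes fin: "finite (carrier R)" and c: "c \<in> carrier R" and S: "S \<subseteq> carrier R"
    and nz: "c \<noteq> \<zero> \<or> card S \<le> n"
  shows "card {ps \<in> random_choices R n. \<forall>x\<in>S. eval (c # ps) x = \<zero>}
       = (if card S \<le> n then card (carrier R) ^ (n - card S) else 0)"
proof -
  have "finite S" using S fin finite_subset by blast
  thus ?thesis using S nz
  proof (induction S arbitrary: n rule: finite_induct)
    case empty
    thus ?case using card_random_choices[OF fin] by simp
  next
    case (insert s S)
    show ?case
    proof (cases n)
      \<comment> \<open>No coefficient is free but a root is demanded, so \<open>nz\<close> forces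
        \<open>c \<noteq> \<zero>\<close>, and a nonzero constant has no root.\<close>
      case 0
      hence "{ps \<in> random_choices R n. \<forall>x\<in>insert s S. eval (c # ps) x = \<zero>} = {}"
        using insert c by (auto simp: random_choices_def)
      hence "card {ps \<in> random_choices R n. \<forall>x\<in>insert s S. eval (c # ps) x = \<zero>} = 0"
        by (simp only: card.empty)
      thus ?thesis using insert 0 by simp
    next
      case (Suc n')
      have "card {ps \<in> random_choices R n. \<forall>x\<in>insert s S. eval (c # ps) x = \<zero>}
          = card {ps \<in> random_choices R n'. \<forall>x\<in>S. eval (c # ps) x = \<zero>}"
        unfolding Suc using insert c by (intro card_vanishing_insert) auto
      also have "\<dots> = (if card S \<le> n' then card (carrier R) ^ (n' - card S) else 0)"
        using insert Suc by (intro insert.IH) auto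
      finally show ?thesis using insert Suc by simp
    qed
  qed
qed

end

section \<open>The probability that a polynomial with given leading coefficient has a root\<close>

definition root_freq :: "('a, 'b) ring_scheme \<Rightarrow> 'a \<Rightarrow> nat \<Rightarrow> real" where
  "root_freq K c n =
    card {ps \<in> random_choices K n. \<exists>x\<in>carrier K. ring.eval K (c # ps) x = \<zero>\<^bsub>K\<^esub>} / card (carrier K) ^ n"

text \<open>Inclusion-exclusion over sets of k roots: there are \<open>q choose k\<close> such sets,
  and for k \<le> n each consists of roots with probability 1 / q^k. The sum is the probability of
  having no root; it stops at n, the largest possible number of roots.\<close>

definition monic_root_freq :: "nat \<Rightarrow> nat \<Rightarrow> real" where
  "monic_root_freq q n = 1 - (\<Sum>k\<le>n. (-1) ^ k * (real (q choose k) / real q ^ k))"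

lemma real_choose_two: "real (n choose 2) = real n * (real n - 1) / 2"
proof (cases n)
  case (Suc m)
  have "even (n * (n - 1))" using Suc by simp
  hence "real (n * (n - 1) div 2) = real (n * (n - 1)) / 2" by (subst real_of_nat_div) auto
  thus ?thesis by (simp add: choose_two Suc algebra_simps)
qed simp

lemma (in ring) finite_random_choices: "finite (carrier R) \<Longrightarrow> finite (random_choices R n)"
  unfolding random_choices_def by (rule finite_lists_length_eq)

context field
begin

text \<open>Binomial moments of the number of roots: pairs of a polynomial and a k-set of its roots
  are counted in both orders.\<close>

lemma sum_choose_roots:
  assumes fin: "finite (carrier R)" and c: "c \<in> carrier R" and nz: "c \<noteq> \<zero> \<or> k \<le> n"
  shows "(\<Sum>ps\<in>random_choices R n. card {x\<in>carrier R. eval (c # ps) x = \<zero>} choose k)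
       = (card (carrier R) choose k) * (if k \<le> n then card (carrier R) ^ (n - k) else 0)"
proof -
  let ?Z = "\<lambda>ps. {x\<in>carrier R. eval (c # ps) x = \<zero>}"
  let ?S = "{S. S \<subseteq> carrier R \<and> card S = k}"
  have finS: "finite ?S" using fin by simp
  have "(\<Sum>ps\<in>random_choices R n. card (?Z ps) choose k)
      = (\<Sum>ps\<in>random_choices R n. \<Sum>S\<in>?S. of_bool (\<forall>x\<in>S. eval (c # ps) x = \<zero>))"
  proof (rule sum.cong[OF refl])
    fix ps
    have "card (?Z ps) choose k = card {S. S \<subseteq> ?Z ps \<and> card S = k}"
      using fin by (intro n_subsets[symmetric]) simp
    also have "{S. S \<subseteq> ?Z ps \<and> card S = k} = ?S \<inter> {S. \<forall>x\<in>S. eval (c # ps) x = \<zero>}"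
      by (auto simp del: eval.simps)
    finally show "card (?Z ps) choose k = (\<Sum>S\<in>?S. of_bool (\<forall>x\<in>S. eval (c # ps) x = \<zero>))"
      using finS by (simp add: sum_of_bool_eq del: eval.simps)
  qed
  also have "\<dots> = (\<Sum>S\<in>?S. \<Sum>ps\<in>random_choices R n. of_bool (\<forall>x\<in>S. eval (c # ps) x = \<zero>))"
    by (rule sum.swap)
  also have "\<dots> = (\<Sum>S\<in>?S. if k \<le> n then card (carrier R) ^ (n - k) else 0)"
  proof (rule sum.cong[OF refl])
    fix S assume "S \<in> ?S"
    with card_vanishing[OF fin c, of S n] nz
    have "card {ps \<in> random_choices R n. \<forall>x\<in>S. eval (c # ps) x = \<zero>}
        = (if k \<le> n then card (carrier R) ^ (n - k) else 0)"
      by (simp del: eval.simps)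
    moreover have "(\<Sum>ps\<in>random_choices R n. of_bool (\<forall>x\<in>S. eval (c # ps) x = \<zero>))
        = card {ps \<in> random_choices R n. \<forall>x\<in>S. eval (c # ps) x = \<zero>}"
      by (subst sum_of_bool_eq[OF finite_random_choices[OF fin]])
         (simp_all add: Int_def finite_random_choices[OF fin] del: eval.simps)
    ultimately show "(\<Sum>ps\<in>random_choices R n. of_bool (\<forall>x\<in>S. eval (c # ps) x = \<zero>))
        = (if k \<le> n then card (carrier R) ^ (n - k) else 0)" by (simp only:)
  qed
  also have "\<dots> = (card (carrier R) choose k) * (if k \<le> n then card (carrier R) ^ (n - k) else 0)"
    using n_subsets[OF fin, of k] by simp
  finally show ?thesis .
qed

lemma card_carrier_ge_2: "finite (carrier R) \<Longrightarrow> card (carrier R) \<ge> 2"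
  using card_mono[of "carrier R" "{\<zero>, \<one>}"] zero_not_one by simp

lemma root_freq_nonzero:
  assumes fin: "finite (carrier R)" and c: "c \<in> carrier R" "c \<noteq> \<zero>"
  shows "root_freq R c n = monic_root_freq (card (carrier R)) n"
proof -
  let ?q = "card (carrier R)"
  let ?T = "random_choices R n"
  let ?Z = "\<lambda>ps. {x\<in>carrier R. eval (c # ps) x = \<zero>}"
  let ?E = "{ps \<in> ?T. \<exists>x\<in>carrier R. eval (c # ps) x = \<zero>}"
  have q: "real ?q > 0" using card_carrier_ge_2[OF fin] by simp
  have finT: "finite ?T" by (rule finite_random_choices[OF fin])
  \<comment> \<open>The summation limit is the field size, common to all polynomials, so that the
    two sums can be interchanged.\<close>
  have alt: "(\<Sum>k\<le>?q. (-1) ^ k * real (z choose k)) = of_bool (z = 0)" if "z \<le> ?q" for z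
  proof -
    have "(\<Sum>k\<le>?q. (-1) ^ k * real (z choose k)) = (\<Sum>k\<le>z. (-1) ^ k * real (z choose k))"
      using that by (intro sum.mono_neutral_right) auto
    also have "\<dots> = of_bool (z = 0)"
      using choose_alternating_sum[of z, where 'a = real] by (cases "z = 0") auto
    finally show ?thesis .
  qed
  have "real (card (?T - ?E)) = (\<Sum>ps\<in>?T. of_bool (card (?Z ps) = 0))"
  proof -
    have "?T - ?E = ?T \<inter> {ps. card (?Z ps) = 0}"
      using fin by (auto simp del: eval.simps)
    thus ?thesis using finT by (simp add: sum_of_bool_eq del: eval.simps)
  qed
  also have "\<dots> = (\<Sum>ps\<in>?T. \<Sum>k\<le>?q. (-1) ^ k * real (card (?Z ps) choose k))"
    by (intro sum.cong refl alt[symmetric] card_mono[OF fin]) auto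
  also have "\<dots> = (\<Sum>k\<le>?q. (-1) ^ k * real (\<Sum>ps\<in>?T. card (?Z ps) choose k))"
    by (subst sum.swap) (simp add: sum_distrib_left)
  also have "\<dots> = (\<Sum>k\<le>?q. (-1) ^ k * real ((?q choose k) * (if k \<le> n then ?q ^ (n - k) else 0)))"
    using sum_choose_roots[OF fin c(1)] c(2) by (simp del: eval.simps)
  \<comment> \<open>For k > n the second factor is 0, for n > q the binomial coefficient is; so both
    ranges give the same sum.\<close>
  also have "\<dots> = (\<Sum>k\<le>n. (-1) ^ k * real ((?q choose k) * (if k \<le> n then ?q ^ (n - k) else 0)))"
    by (rule sum.mono_neutral_cong) auto
  also have "\<dots> = (\<Sum>k\<le>n. (-1) ^ k * (real (?q choose k) / real ?q ^ k)) * real ?q ^ n"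
    unfolding sum_distrib_right
  proof (intro sum.cong refl)
    fix k assume "k \<in> {..n}"
    hence "real ?q ^ n = real ?q ^ k * real ?q ^ (n - k)" by (simp flip: power_add)
    thus "(-1) ^ k * real ((?q choose k) * (if k \<le> n then ?q ^ (n - k) else 0))
        = (-1) ^ k * (real (?q choose k) / real ?q ^ k) * real ?q ^ n"
      using \<open>k \<in> {..n}\<close> q by simp
  qed
  finally have "real (card (?T - ?E)) = (1 - monic_root_freq ?q n) * real ?q ^ n"
    by (simp add: monic_root_freq_def)
  moreover have "card (?T - ?E) = card ?T - card ?E" "card ?E \<le> card ?T"
    using finT by (auto intro: card_Diff_subset card_mono simp del: eval.simps)
  ultimately have "real (card ?E) = monic_root_freq ?q n * real ?q ^ n"
    using card_random_choices[OF fin, of n] by (simp add: of_nat_diff algebra_simps del: eval.simps)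
  thus ?thesis using q by (simp add: root_freq_def del: eval.simps)
qed

text \<open>The second Bonferroni inequality gives at least 1 - (q - 1) / (2q). It uses only the
  moments k = 1 and k = 2, which for n \<ge> 2 are known for \<open>c = \<zero>\<close> as
  well.\<close>

lemma root_freq_ge_half:
  assumes fin: "finite (carrier R)" and c: "c \<in> carrier R" and n: "2 \<le> n"
  shows "root_freq R c n \<ge> 1 / 2"
proof -
  let ?q = "card (carrier R)"
  let ?T = "random_choices R n"
  let ?Z = "\<lambda>ps. {x\<in>carrier R. eval (c # ps) x = \<zero>}"
  let ?E = "{ps \<in> ?T. \<exists>x\<in>carrier R. eval (c # ps) x = \<zero>}"
  obtain m where m: "n = m + 2" using n by (metis le_add_diff_inverse2)
  have q: "real ?q > 0" using card_carrier_ge_2[OF fin] by simp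
  have finT: "finite ?T" by (rule finite_random_choices[OF fin])
  \<comment> \<open>For z \<ge> 1 the claim amounts to (z - 1)(z - 2) \<ge> 0.\<close>
  have bonf: "real (z choose 1) - real (z choose 2) \<le> of_bool (z \<noteq> 0)" for z
  proof (cases "z \<le> 1")
    case False
    have "0 \<le> (real z - 1) * (real z - 2)" using False by simp
    thus ?thesis using False by (simp add: real_choose_two field_simps)
  qed (auto simp: le_Suc_eq)
  have "(\<Sum>ps\<in>?T. card (?Z ps) choose 1) = ?q * (?q * ?q ^ m)"
    using sum_choose_roots[OF fin c, of 1 n] m by (simp del: eval.simps)
  moreover have "(\<Sum>ps\<in>?T. card (?Z ps) choose 2) = (?q choose 2) * ?q ^ m"
    using sum_choose_roots[OF fin c, of 2 n] m by (simp del: eval.simps)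
  ultimately have "real (?q * (?q * ?q ^ m)) - real ((?q choose 2) * ?q ^ m)
      = (\<Sum>ps\<in>?T. real (card (?Z ps) choose 1) - real (card (?Z ps) choose 2))"
    by (simp only: sum_subtractf of_nat_sum[symmetric])
  also have "\<dots> \<le> (\<Sum>ps\<in>?T. of_bool (card (?Z ps) \<noteq> 0))"
    by (intro sum_mono bonf)
  also have "\<dots> = real (card ?E)"
  proof -
    have "?T \<inter> {ps. card (?Z ps) \<noteq> 0} = ?E"
      using fin by (auto simp del: eval.simps)
    thus ?thesis using finT by (simp add: sum_of_bool_eq del: eval.simps)
  qed
  finally have "real ?q * (real ?q * real ?q ^ m) - (real ?q * (real ?q - 1) / 2) * real ?q ^ m
      \<le> real (card ?E)"
    by (simp add: real_choose_two del: eval.simps)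
  moreover have "real ?q ^ n / 2
      \<le> real ?q * (real ?q * real ?q ^ m) - (real ?q * (real ?q - 1) / 2) * real ?q ^ m"
    using q by (simp add: m field_simps power2_eq_square)
  ultimately show ?thesis using q by (simp add: root_freq_def field_simps del: eval.simps)
qed

lemma root_freq_le_1:
  assumes fin: "finite (carrier R)"
  shows "root_freq R c n \<le> 1"
proof -
  have "card {ps \<in> random_choices R n. \<exists>x\<in>carrier R. eval (c # ps) x = \<zero>} \<le> card (carrier R) ^ n"
    unfolding card_random_choices[OF fin, symmetric]
    by (intro card_mono finite_random_choices[OF fin]) auto
  hence "real (card {ps \<in> random_choices R n. \<exists>x\<in>carrier R. eval (c # ps) x = \<zero>})
      \<le> real (card (carrier R)) ^ n"
    by (simp only: of_nat_le_iff flip: of_nat_power)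
  thus ?thesis using card_carrier_ge_2[OF fin]
    by (simp add: root_freq_def field_simps del: eval.simps)
qed

end

section \<open>Convergence of the root frequency to \<open>mu d\<close>\<close>

lemma tendsto_choose_div_power:
  "(\<lambda>q. real (q choose k) / real q ^ k) \<longlonglongrightarrow> 1 / fact k"
proof (induction k)
  case (Suc k)
  have "(\<lambda>q. real k / real q) \<longlonglongrightarrow> 0" by (rule lim_const_over_n)
  hence "(\<lambda>q. (1 - real k / real q) / (real k + 1)) \<longlonglongrightarrow> (1 - 0) / (real k + 1)"
    by (intro tendsto_intros) auto
  hence lim: "(\<lambda>q. real (q choose k) / real q ^ k * ((1 - real k / real q) / (real k + 1)))
      \<longlonglongrightarrow> 1 / fact k * (1 / (real k + 1))"
    by (intro tendsto_mult Suc.IH) simp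
  \<comment> \<open>Consecutive terms differ by the factor (1 - k/q) / (k + 1), because (k + 1) (q
    choose k + 1) = (q - k) (q choose k).\<close>
  have "eventually (\<lambda>q. real (q choose k) / real q ^ k * ((1 - real k / real q) / (real k + 1))
      = real (q choose Suc k) / real q ^ Suc k) sequentially"
    using eventually_gt_at_top[of 0]
  proof eventually_elim
    case (elim q)
    have "real (q choose Suc k) * (real k + 1) = real (q choose k) * (real q - real k)"
    proof (cases "k \<le> q")
      case True
      have "Suc k * (q choose Suc k) = (q - k) * (q choose k)"
        by (simp only: binomial_absorption binomial_absorb_comp)
      hence "real (Suc k * (q choose Suc k)) = real ((q - k) * (q choose k))" by simp
      thus ?thesis using True by (simp add: of_nat_diff algebra_simps)
    qed (simp add: binomial_eq_0)
    hence choose: "real (q choose Suc k) = real (q choose k) * (real q - real k) / (real k + 1)"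
      by (simp add: field_simps)
    have "1 - real k / real q = (real q - real k) / real q" using elim by (simp add: field_simps)
    thus ?case unfolding choose by (simp add: mult_ac)
  qed
  from Lim_transform_eventually[OF lim this] show ?case by (simp add: field_simps)
qed simp

lemma monic_root_freq_tendsto: "(\<lambda>q. monic_root_freq q d) \<longlonglongrightarrow> mu d"
proof -
  have "(\<lambda>q. monic_root_freq q d) \<longlonglongrightarrow> 1 - (\<Sum>k\<le>d. (-1) ^ k * (1 / fact k))"
    unfolding monic_root_freq_def by (intro tendsto_intros tendsto_choose_div_power)
  \<comment> \<open>The term k = 0 is the 1; the other terms are those of \<open>mu d\<close> with
    opposite sign.\<close>
  also have "(\<Sum>k\<le>d. (-1) ^ k * (1 / fact k :: real)) = 1 - mu d"
  proof -
    have "(\<Sum>k\<le>d. (-1) ^ k * (1 / fact k :: real)) = 1 + (\<Sum>k=1..d. (-1) ^ k * (1 / fact k))"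
      by (simp add: sum.atLeast_Suc_atMost atMost_atLeast0)
    also have "(\<Sum>k=1..d. (-1) ^ k * (1 / fact k :: real)) = - mu d"
      unfolding mu_def sum_negf[symmetric]
    proof (rule sum.cong[OF refl])
      fix k assume "k \<in> {1..d}"
      then obtain j where "k = Suc j" by (cases k) auto
      thus "(-1) ^ k * (1 / fact k) = - ((-1) ^ (k - 1) / fact k :: real)" by simp
    qed
    finally show ?thesis by simp
  qed
  finally show ?thesis by simp
qed

section \<open>The expected length of a search\<close>

fun search_length :: "'a set \<Rightarrow> 'a list \<Rightarrow> nat" where
  "search_length A [] = 0"
| "search_length A (a # as) = (if a \<in> A then 1 else Suc (search_length A as))"

text \<open>In a random order of n elements, the first of N > 0 marked ones has mean position (n +
  1) / (N + 1); for N = 0 the search has length n, below the bound n + 1. The induction conditions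
  on the first element: it is marked and ends the search, or it is removed and all of
  \<open>A\<close> remains.\<close>

lemma sum_search_length_le:
  assumes "finite S" "A \<subseteq> S"
  shows "(\<Sum>as\<in>permutations_of_set S. real (search_length A as))
    \<le> fact (card S) * ((real (card S) + 1) / (real (card A) + 1))"
  using assms
proof (induction "card S" arbitrary: S)
  case 0
  thus ?case by simp
next
  case (Suc n)
  hence ne: "S \<noteq> {}" and finA: "finite A" and cS: "card S = Suc n"
    by (auto intro: finite_subset)
  let ?N = "card A"
  have le: "?N \<le> Suc n" using Suc.prems card_mono[of S A] cS by simp
  have fact1: "card (permutations_of_set (S - {x})) = fact n" if "x \<in> S" for x
    using that Suc.prems cS by simp
  have step: "(\<Sum>as\<in>permutations_of_set (S - {x}). real (search_length A (x # as)))
      \<le> (if x \<in> A then fact n else fact n + fact n * ((real n + 1) / (real ?N + 1)))"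
    if x: "x \<in> S" for x
  proof (cases "x \<in> A")
    case True
    thus ?thesis using fact1[OF x] by simp
  next
    case False
    have "(\<Sum>as\<in>permutations_of_set (S - {x}). real (search_length A as))
        \<le> fact (card (S - {x})) * ((real (card (S - {x})) + 1) / (real ?N + 1))"
      using Suc.prems x cS False by (intro Suc.hyps(1)) auto
    thus ?thesis using fact1[OF x] x cS Suc.prems False
      by (simp add: sum.distrib)
  qed
  have "(\<Sum>as\<in>permutations_of_set S. real (search_length A as))
      = (\<Sum>x\<in>S. \<Sum>as\<in>permutations_of_set (S - {x}). real (search_length A (x # as)))"
    unfolding permutations_of_set_nonempty[OF ne]
    using Suc.prems
    by (subst sum.UNION_disjoint) (auto simp: sum.reindex intro!: sum.cong)
  also have "\<dots> \<le> (\<Sum>x\<in>S. if x \<in> A then fact n else fact n + fact n * ((real n + 1) / (real ?N + 1)))"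
    by (intro sum_mono step)
  also have "\<dots> = real ?N * fact n
      + (real (Suc n) - real ?N) * (fact n + fact n * ((real n + 1) / (real ?N + 1)))"
  proof -
    have "S \<inter> {x. x \<in> A} = A" "S \<inter> - {x. x \<in> A} = S - A" using Suc.prems by auto
    thus ?thesis using Suc.prems finA le cS
      by (simp add: sum.If_cases card_Diff_subset of_nat_diff)
  qed
  also have "\<dots> = fact (card S) * ((real (card S) + 1) / (real ?N + 1))"
    unfolding cS by (simp add: field_simps)
  finally show ?case .
qed

text \<open>
  With \<open>M = p |I| + 1\<close> one has
  \<open>1 / (N + 1) = 1 / M - (N + 1 - M) / M\<^sup>2 + (N + 1 - M)\<^sup>2 / (M\<^sup>2 (N + 1))\<close>. The second term has
  mean 0 and the third one is at most \<open>(N + 1 - M)\<^sup>2 / M\<^sup>2\<close>, whose mean is the variance of \<open>N\<close>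
  divided by \<open>M\<^sup>2\<close>.
\<close>

lemma pairwise_independent_sum_inverse_le:
  fixes E :: "'i \<Rightarrow> 'w \<Rightarrow> bool" and p :: real
  assumes fin: "finite B" "finite I"
    and p: "0 < p" "p \<le> 1"
    and single: "\<And>a. a \<in> I \<Longrightarrow> (\<Sum>w\<in>B. of_bool (E a w)) = p * card B"
    and pair: "\<And>a b. a \<in> I \<Longrightarrow> b \<in> I \<Longrightarrow> a \<noteq> b \<Longrightarrow>
      (\<Sum>w\<in>B. of_bool (E a w) * of_bool (E b w)) = p\<^sup>2 * card B"
  shows "(\<Sum>w\<in>B. (real (card I) + 1) / (real (card {a\<in>I. E a w}) + 1))
    \<le> card B * (1 / p + (1 - p) / p)"
proof -
  define n where "n = real (card I)"
  define b where "b = real (card B)"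
  define N where "N = (\<lambda>w. real (card {a\<in>I. E a w}))"
  define M where "M = p * n + 1"
  have n0: "n \<ge> 0" and b0: "b \<ge> 0" by (simp_all add: n_def b_def)
  have M: "M > 0" using p n0 by (simp add: M_def add_nonneg_pos)
  have N: "N w = (\<Sum>a\<in>I. of_bool (E a w))" for w
    using fin by (simp add: N_def sum_of_bool_eq Int_def)
  have sN: "(\<Sum>w\<in>B. N w) = n * (p * b)"
    unfolding N by (subst sum.swap) (simp add: single n_def b_def)
  have "(\<Sum>w\<in>B. (N w)\<^sup>2) = (\<Sum>a\<in>I. \<Sum>c\<in>I. \<Sum>w\<in>B. of_bool (E a w) * of_bool (E c w))"
    unfolding N power2_eq_square sum_product
    by (subst sum.swap, intro sum.cong refl, subst sum.swap, rule refl)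
  \<comment> \<open>Pairs with \<open>c \<noteq> a\<close> contribute \<open>p\<^sup>2 * b\<close>
    by pairwise independence, diagonal ones \<open>p * b\<close> because an indicator equals its
    square.\<close>
  also have "\<dots> = (\<Sum>a\<in>I. \<Sum>c\<in>I. p\<^sup>2 * b + (if c = a then p * b - p\<^sup>2 * b else 0))"
  proof (intro sum.cong refl)
    fix a c assume ac: "a \<in> I" "c \<in> I"
    show "(\<Sum>w\<in>B. of_bool (E a w) * of_bool (E c w)) = p\<^sup>2 * b + (if c = a then p * b - p\<^sup>2 * b else 0)"
    proof (cases "c = a")
      case True
      thus ?thesis using single[OF ac(1)] by (simp add: b_def flip: of_bool_conj)
    next
      case False
      thus ?thesis using pair[OF ac] by (simp add: b_def)
    qed
  qed
  also have "\<dots> = n * (n * (p\<^sup>2 * b) + (p * b - p\<^sup>2 * b))"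
    using fin by (simp add: sum.distrib n_def algebra_simps)
  finally have sN2: "(\<Sum>w\<in>B. (N w)\<^sup>2) = n * (n * (p\<^sup>2 * b) + (p * b - p\<^sup>2 * b))" .
  have var: "(\<Sum>w\<in>B. (N w - p * n)\<^sup>2) = b * (n * p * (1 - p))"
  proof -
    have "(\<Sum>w\<in>B. (N w - p * n)\<^sup>2) = (\<Sum>w\<in>B. (N w)\<^sup>2 - 2 * p * n * N w + (p * n)\<^sup>2)"
      by (intro sum.cong refl) (simp add: power2_diff)
    also have "\<dots> = (\<Sum>w\<in>B. (N w)\<^sup>2) - 2 * p * n * (\<Sum>w\<in>B. N w) + b * (p * n)\<^sup>2"
      by (simp add: sum.distrib sum_subtractf sum_distrib_left b_def)
    also have "\<dots> = b * (n * p * (1 - p))"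
      unfolding sN sN2 by (simp add: algebra_simps power2_eq_square)
    finally show ?thesis .
  qed
  have pointwise: "1 / (N w + 1) \<le> 1 / M - (N w - p * n) / M\<^sup>2 + (N w - p * n)\<^sup>2 / M\<^sup>2" for w
  proof -
    have Nw: "N w \<ge> 0" by (simp add: N_def)
    have "1 / (N w + 1) = 1 / M - (N w - p * n) / M\<^sup>2 + (N w - p * n)\<^sup>2 / M\<^sup>2 / (N w + 1)"
    proof -
      have u: "N w - p * n = (N w + 1) - M" by (simp add: M_def)
      have "N w + 1 \<noteq> 0" using Nw by simp
      thus ?thesis unfolding u using M
        by (simp add: divide_simps) (simp add: algebra_simps power2_eq_square)
    qed
    also have "(N w - p * n)\<^sup>2 / M\<^sup>2 / (N w + 1) \<le> (N w - p * n)\<^sup>2 / M\<^sup>2 / 1"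
      using Nw by (intro divide_left_mono) auto
    finally show ?thesis by simp
  qed
  have "(\<Sum>w\<in>B. 1 / (N w + 1)) \<le> (\<Sum>w\<in>B. 1 / M - (N w - p * n) / M\<^sup>2 + (N w - p * n)\<^sup>2 / M\<^sup>2)"
    by (intro sum_mono pointwise)
  also have "\<dots> = b / M - ((\<Sum>w\<in>B. N w) - b * (p * n)) / M\<^sup>2 + (\<Sum>w\<in>B. (N w - p * n)\<^sup>2) / M\<^sup>2"
    by (simp add: sum.distrib sum_subtractf sum_divide_distrib[symmetric] b_def)
  also have "\<dots> = b * (1 / M + n * p * (1 - p) / M\<^sup>2)"
    unfolding sN var by (simp add: algebra_simps)
  finally have le: "(\<Sum>w\<in>B. 1 / (N w + 1)) \<le> b * (1 / M + n * p * (1 - p) / M\<^sup>2)" .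
  have r: "(n + 1) / M \<le> 1 / p"
    using M p n0 by (simp add: divide_simps M_def algebra_simps)
  have "(\<Sum>w\<in>B. (n + 1) / (N w + 1)) = (n + 1) * (\<Sum>w\<in>B. 1 / (N w + 1))"
    by (simp add: sum_distrib_left)
  also have "\<dots> \<le> (n + 1) * (b * (1 / M + n * p * (1 - p) / M\<^sup>2))"
    using le n0 by (intro mult_left_mono) auto
  \<comment> \<open>Splits the variance term into (n + 1) / M, at most 1 / p, and n p / M, at most
    1.\<close>
  also have "\<dots> = b * ((n + 1) / M * 1 + (n + 1) / M * ((1 - p) * (n * p / M)))"
    by (simp add: divide_simps power2_eq_square) (simp add: algebra_simps)
  also have "\<dots> \<le> b * (1 / p * 1 + 1 / p * ((1 - p) * 1))"
  proof -
    have "n * p / M \<le> 1" using M by (simp add: M_def divide_simps)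
    hence "(1 - p) * (n * p / M) \<le> (1 - p) * 1" using p by (intro mult_left_mono) auto
    moreover have "0 \<le> (1 - p) * (n * p / M)" using p M n0 by simp
    ultimately have "(n + 1) / M * ((1 - p) * (n * p / M)) \<le> 1 / p * ((1 - p) * 1)"
      using p by (intro mult_mono[OF r]) (simp_all only: zero_le_divide_1_iff less_imp_le)
    with r have "(n + 1) / M * 1 + (n + 1) / M * ((1 - p) * (n * p / M)) \<le> 1 / p * 1 + 1 / p * ((1 - p) * 1)"
      by linarith
    thus ?thesis using b0 by (rule mult_left_mono)
  qed
  finally show ?thesis by (simp add: n_def b_def N_def)
qed

section \<open>The restrictions to two strips\<close>

text \<open>As \<open>le\<close> is symmetric in \<open>t\<close> and \<open>u\<close>, one
  inequality between fibers already makes all fibers equally large. A proof of it only has to inject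
  one fiber into another.\<close>

lemma card_equidistributed:
  assumes fin: "finite B" "finite T" and maps: "\<And>b. b \<in> B \<Longrightarrow> f b \<in> T" and sub: "T' \<subseteq> T"
    and le: "\<And>t u. t \<in> T \<Longrightarrow> u \<in> T \<Longrightarrow> card {b\<in>B. f b = t} \<le> card {b\<in>B. f b = u}"
  shows "card {b\<in>B. f b \<in> T'} * card T = card B * card T'"
proof (cases "T = {}")
  case True
  hence "B = {}" "T' = {}" using maps sub by auto
  thus ?thesis by simp
next
  case False
  then obtain u where u: "u \<in> T" by blast
  have fibers: "card {b\<in>B. f b \<in> U} = card U * card {b\<in>B. f b = u}" if U: "U \<subseteq> T" for U
  proof -
    have finU: "finite U" using U fin finite_subset by blast
    have "{b\<in>B. f b \<in> U} = (\<Union>t\<in>U. {b\<in>B. f b = t})" by auto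
    hence "card {b\<in>B. f b \<in> U} = (\<Sum>t\<in>U. card {b\<in>B. f b = t})"
      using finU fin by (simp only:) (rule card_UN_disjoint, auto)
    also have "\<dots> = (\<Sum>t\<in>U. card {b\<in>B. f b = u})"
      using U u le by (intro sum.cong refl antisym) auto
    finally show ?thesis by simp
  qed
  have "{b\<in>B. f b \<in> T} = B" using maps by auto
  with fibers[OF order_refl] have "card B = card T * card {b\<in>B. f b = u}" by simp
  thus ?thesis using fibers[OF sub] by simp
qed

text \<open>The coefficients of \<open>F(a, X\<^sub>2)\<close> after the one of \<open>X\<^sub>2\<^sup>d\<close>, which does not depend on \<open>a\<close>.\<close>

definition strip_tail ::
    "('a, 'b) ring_scheme \<Rightarrow> nat \<Rightarrow> (nat \<times> nat \<Rightarrow> 'a) \<Rightarrow> 'a \<Rightarrow> 'a list" where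
  "strip_tail K d F a = map (strip_coeff K d F a) (rev [0..<d])"

definition has_root :: "('a, 'b) ring_scheme \<Rightarrow> nat \<Rightarrow> (nat \<times> nat \<Rightarrow> 'a) \<Rightarrow> 'a \<Rightarrow> bool" where
  "has_root K d F a \<longleftrightarrow> (\<exists>x\<in>carrier K. ring.eval K (strip_poly K d F a) x = \<zero>\<^bsub>K\<^esub>)"

definition bipolys_top :: "('a, 'b) ring_scheme \<Rightarrow> nat \<Rightarrow> 'a \<Rightarrow> (nat \<times> nat \<Rightarrow> 'a) set" where
  "bipolys_top K d c = {F \<in> bipolys K d. F (0, d) = c}"

lemma finite_exponents: "finite (exponents d)"
  by (rule finite_subset[of _ "{..d} \<times> {..d}"]) (auto simp: exponents_def)

lemma finite_bipolys: "finite (carrier K) \<Longrightarrow> finite (bipolys K d)"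
  unfolding bipolys_def by (intro finite_PiE finite_exponents)

context field
begin

lemma bipolys_carrier: "F \<in> bipolys R d \<Longrightarrow> i + j \<le> d \<Longrightarrow> F (i, j) \<in> carrier R"
  by (auto simp: bipolys_def exponents_def)

lemma random_choices_nth: "ps \<in> random_choices R n \<Longrightarrow> k < n \<Longrightarrow> ps ! k \<in> carrier R"
  unfolding random_choices_def using nth_mem by blast

lemma strip_coeff_carrier:
  assumes "F \<in> bipolys R d" "a \<in> carrier R" "j \<le> d"
  shows "strip_coeff R d F a j \<in> carrier R"
  unfolding strip_coeff_def using assms bipolys_carrier[OF assms(1)]
  by (intro finsum_closed) auto

lemma strip_tail_random_choices:
  assumes "F \<in> bipolys R d" "a \<in> carrier R"
  shows "strip_tail R d F a \<in> random_choices R d"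
  using assms by (auto simp: strip_tail_def random_choices_def intro: strip_coeff_carrier)

lemma strip_coeffs_eq:
  assumes "F \<in> bipolys R d"
  shows "map (strip_coeff R d F a) (rev [0..<d + 1]) = F (0, d) # strip_tail R d F a"
  using assms by (simp add: strip_tail_def strip_coeff_def bipolys_carrier)

text \<open>Dropping leading zeros does not change values, so the fixed-length list can replace the
  normalized polynomial even if \<open>F (0, d)\<close> is zero.\<close>

lemma has_root_iff:
  assumes "F \<in> bipolys R d" "a \<in> carrier R"
  shows "has_root R d F a \<longleftrightarrow> (\<exists>x\<in>carrier R. eval (F (0, d) # strip_tail R d F a) x = \<zero>)"
proof -
  have "set (F (0, d) # strip_tail R d F a) \<subseteq> carrier R"
    using bipolys_carrier[OF assms(1), of 0 d] strip_tail_random_choices[OF assms]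
    by (auto simp: random_choices_def)
  thus ?thesis
    unfolding has_root_def strip_poly_def strip_coeffs_eq[OF assms(1)]
    using eval_normalize by (simp del: eval.simps normalize.simps)
qed

lemma strip_poly_closed:
  assumes "F \<in> bipolys R d" "a \<in> carrier R"
  shows "strip_poly R d F a \<in> carrier (poly_ring R)"
  using assms by (intro strip_poly_carrier) (auto intro: strip_coeff_carrier)

text \<open>The upper limit \<open>Suc n\<close> ensures that the exponents 0 and 1 both occur; it
  is met by d - j for j < d.\<close>

lemma finsum_linear:
  assumes "u \<in> carrier R" "v \<in> carrier R" "x \<in> carrier R"
  shows "(\<Oplus>i\<in>{..Suc n}. (if i = 0 then u else if i = 1 then v else \<zero>) \<otimes> x [^] i) = u \<oplus> v \<otimes> x"
proof (induction n)
  case 0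
  have "{..Suc 0} = insert 1 {0::nat}" by auto
  thus ?case using assms by (simp add: add.m_comm)
next
  case (Suc n)
  have "{..Suc (Suc n)} = insert (Suc (Suc n)) {..Suc n}" by auto
  thus ?case using assms Suc by simp
qed

text \<open>Linear interpolation with slope (z - y) / (b - a). This is where the distinctness of the
  two strips enters.\<close>

lemma ex_line_through:
  assumes "a \<in> carrier R" "b \<in> carrier R" "a \<noteq> b" "y \<in> carrier R" "z \<in> carrier R"
  shows "\<exists>u\<in>carrier R. \<exists>v\<in>carrier R. u \<oplus> v \<otimes> a = y \<and> u \<oplus> v \<otimes> b = z"
proof -
  have nz: "b \<ominus> a \<noteq> \<zero>" "b \<ominus> a \<in> carrier R" using assms by auto
  hence U: "b \<ominus> a \<in> Units R" by (simp add: field_Units)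
  define v where "v = (z \<ominus> y) \<otimes> inv (b \<ominus> a)"
  have v: "v \<in> carrier R" using assms U unfolding v_def by simp
  have "v \<otimes> (b \<ominus> a) = (z \<ominus> y) \<otimes> (inv (b \<ominus> a) \<otimes> (b \<ominus> a))"
    unfolding v_def using assms nz U by (intro m_assoc) auto
  hence vba: "v \<otimes> (b \<ominus> a) = z \<ominus> y" using assms U by simp
  have "(y \<ominus> v \<otimes> a) \<oplus> v \<otimes> a = y" using assms v by algebra
  moreover have "(y \<ominus> v \<otimes> a) \<oplus> v \<otimes> b = y \<oplus> v \<otimes> (b \<ominus> a)" using assms v by algebra
  moreover have "y \<oplus> (z \<ominus> y) = z" using assms by algebra
  ultimately show ?thesis using v assms vba by (intro bexI[of _ "y \<ominus> v \<otimes> a"] bexI[of _ v]) auto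
qed

text \<open>
  Adding \<open>(u\<^sub>j + v\<^sub>j X\<^sub>1) X\<^sub>2\<^sup>j\<close> for all \<open>j < d\<close> permutes the polynomials with given coefficient of
  \<open>X\<^sub>2\<^sup>d\<close> and moves one fiber of the pair of restrictions to the strips \<open>a\<close> and \<open>b\<close> to any other.
\<close>

lemma card_strip_tails_le:
  assumes fin: "finite (carrier R)" and ab: "a \<in> carrier R" "b \<in> carrier R" "a \<noteq> b"
    and t: "t \<in> random_choices R d \<times> random_choices R d"
    and w: "w \<in> random_choices R d \<times> random_choices R d"
  shows "card {F \<in> bipolys_top R d c. (strip_tail R d F a, strip_tail R d F b) = t}
      \<le> card {F \<in> bipolys_top R d c. (strip_tail R d F a, strip_tail R d F b) = w}"
    (is "card (?fib t) \<le> card (?fib w)")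
proof -
  \<comment> \<open>Tails run from degree d - 1 down to 0, so the coefficient of X2^j stands at
    position \<open>?ix j\<close>; on indices below d, \<open>?ix\<close> is its own
    inverse.\<close>
  let ?ix = "\<lambda>j. d - Suc j"
  have nth: "fst t ! k \<in> carrier R" "snd t ! k \<in> carrier R" "fst w ! k \<in> carrier R" "snd w ! k \<in> carrier R"
    if "k < d" for k
    using t w that random_choices_nth[of _ d k] by (simp_all add: mem_Times_iff)
  \<comment> \<open>For each j, a line in X1 whose values at \<open>a\<close> and \<open>b\<close>
    are the corrections that turn the tails \<open>t\<close> into the tails
    \<open>w\<close>.\<close>
  have "\<forall>j\<in>{..<d}. \<exists>uv. fst uv \<in> carrier R \<and> snd uv \<in> carrier R \<and>
      fst uv \<oplus> snd uv \<otimes> a = fst w ! ?ix j \<ominus> fst t ! ?ix j \<and>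
      fst uv \<oplus> snd uv \<otimes> b = snd w ! ?ix j \<ominus> snd t ! ?ix j"
  proof
    fix j assume "j \<in> {..<d}"
    hence "?ix j < d" by simp
    from nth[OF this] ex_line_through[OF ab, of "fst w ! ?ix j \<ominus> fst t ! ?ix j" "snd w ! ?ix j \<ominus> snd t ! ?ix j"]
    obtain u v where "u \<in> carrier R" "v \<in> carrier R"
      "u \<oplus> v \<otimes> a = fst w ! ?ix j \<ominus> fst t ! ?ix j" "u \<oplus> v \<otimes> b = snd w ! ?ix j \<ominus> snd t ! ?ix j"
      by auto
    thus "\<exists>uv. fst uv \<in> carrier R \<and> snd uv \<in> carrier R \<and>
      fst uv \<oplus> snd uv \<otimes> a = fst w ! ?ix j \<ominus> fst t ! ?ix j \<and>
      fst uv \<oplus> snd uv \<otimes> b = snd w ! ?ix j \<ominus> snd t ! ?ix j"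
      by (intro exI[of _ "(u, v)"]) simp
  qed
  then obtain g where "\<forall>j\<in>{..<d}. fst (g j) \<in> carrier R \<and> snd (g j) \<in> carrier R \<and>
      fst (g j) \<oplus> snd (g j) \<otimes> a = fst w ! ?ix j \<ominus> fst t ! ?ix j \<and>
      fst (g j) \<oplus> snd (g j) \<otimes> b = snd w ! ?ix j \<ominus> snd t ! ?ix j"
    unfolding bchoice_iff by (rule exE)
  hence g: "fst (g j) \<in> carrier R \<and> snd (g j) \<in> carrier R \<and>
      fst (g j) \<oplus> snd (g j) \<otimes> a = fst w ! ?ix j \<ominus> fst t ! ?ix j \<and>
      fst (g j) \<oplus> snd (g j) \<otimes> b = snd w ! ?ix j \<ominus> snd t ! ?ix j" if "j < d" for j
    using that by (simp only: lessThan_iff Ball_def)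
  \<comment> \<open>D is zero at (0, d), so \<open>c\<close> is preserved. For j < d the exponents
    (0, j) and (1, j) have total degree at most d, so the correction stays among the admissible
    polynomials.\<close>
  define D where "D = (\<lambda>(i::nat, j). if j < d then (if i = 0 then fst (g j) else if i = 1 then snd (g j) else \<zero>) else \<zero>)"
  define \<phi> where "\<phi> = (\<lambda>F. restrict (\<lambda>e. F e \<oplus> D e) (exponents d))"
  have D: "D e \<in> carrier R" for e using g by (cases e) (auto simp: D_def)
  have \<phi>_top: "\<phi> F \<in> bipolys_top R d c" if "F \<in> bipolys_top R d c" for F
  proof -
    have "F \<in> bipolys R d" "F (0, d) = c" using that by (auto simp: bipolys_top_def)
    hence "\<phi> F \<in> bipolys R d" "\<phi> F (0, d) = c"
      using D bipolys_carrier[of F d 0 d] by (auto simp: \<phi>_def bipolys_def D_def exponents_def)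
    thus ?thesis by (simp add: bipolys_top_def)
  qed
  have coeff: "strip_coeff R d (\<phi> F) x j = strip_coeff R d F x j \<oplus> (fst (g j) \<oplus> snd (g j) \<otimes> x)"
    if F: "F \<in> bipolys R d" and x: "x \<in> carrier R" and j: "j < d" for F x j
  proof -
    obtain n where n: "d - j = Suc n" using j by (metis Suc_diff_Suc)
    have Fc: "F (i, j) \<in> carrier R" if "i \<in> {..d - j}" for i
      using that j by (intro bipolys_carrier[OF F]) auto
    have "strip_coeff R d (\<phi> F) x j = (\<Oplus>i\<in>{..d - j}. F (i, j) \<otimes> x [^] i \<oplus> D (i, j) \<otimes> x [^] i)"
      unfolding strip_coeff_def
    proof (rule finsum_cong'[OF refl])
      show "(\<lambda>i. F (i, j) \<otimes> x [^] i \<oplus> D (i, j) \<otimes> x [^] i) \<in> {..d - j} \<rightarrow> carrier R"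
        using Fc D x by simp
      fix i assume i: "i \<in> {..d - j}"
      hence "(i, j) \<in> exponents d" using j by (auto simp: exponents_def)
      thus "\<phi> F (i, j) \<otimes> x [^] i = F (i, j) \<otimes> x [^] i \<oplus> D (i, j) \<otimes> x [^] i"
        using Fc[OF i] D x by (simp add: \<phi>_def l_distr)
    qed
    also have "\<dots> = (\<Oplus>i\<in>{..d - j}. F (i, j) \<otimes> x [^] i) \<oplus> (\<Oplus>i\<in>{..d - j}. D (i, j) \<otimes> x [^] i)"
      using Fc D x by (intro finsum_addf) auto
    also have "(\<Oplus>i\<in>{..d - j}. D (i, j) \<otimes> x [^] i) = fst (g j) \<oplus> snd (g j) \<otimes> x"
      using finsum_linear[of "fst (g j)" "snd (g j)" x n] g[OF j] x j n by (simp add: D_def)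
    finally show ?thesis by (simp add: strip_coeff_def)
  qed
  have tail: "strip_tail R d (\<phi> F) x = w'"
    if F: "F \<in> bipolys R d" and x: "x \<in> carrier R" and t': "strip_tail R d F x = t'"
      and w': "w' \<in> random_choices R d"
      and g': "\<And>j. j < d \<Longrightarrow> fst (g j) \<oplus> snd (g j) \<otimes> x = w' ! ?ix j \<ominus> t' ! ?ix j" for F x t' w'
  proof (rule nth_equalityI)
    show "length (strip_tail R d (\<phi> F) x) = length w'"
      using w' by (simp add: strip_tail_def random_choices_def)
    fix k assume "k < length (strip_tail R d (\<phi> F) x)"
    hence k: "k < d" by (simp add: strip_tail_def)
    hence j: "?ix k < d" "?ix (?ix k) = k" by auto
    have tail_nth: "strip_tail R d H x ! k = strip_coeff R d H x (?ix k)" for H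
      using k by (simp add: strip_tail_def rev_nth)
    have "strip_coeff R d F x (?ix k) = t' ! k" using tail_nth[of F] t' by simp
    moreover have "t' ! k \<in> carrier R" "w' ! k \<in> carrier R"
      using random_choices_nth[OF w' k] random_choices_nth[OF strip_tail_random_choices[OF F x] k] t'
      by auto
    ultimately have "strip_coeff R d (\<phi> F) x (?ix k) = w' ! k"
      unfolding coeff[OF F x j(1)] g'[OF j(1)] j(2) by (simp; algebra)
    thus "strip_tail R d (\<phi> F) x ! k = w' ! k" by (simp only: tail_nth)
  qed
  have "\<phi> ` ?fib t \<subseteq> ?fib w"
  proof
    fix H assume "H \<in> \<phi> ` ?fib t"
    then obtain F where F: "F \<in> bipolys_top R d c" "strip_tail R d F a = fst t"
        "strip_tail R d F b = snd t" and H: "H = \<phi> F" by auto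
    have Fb: "F \<in> bipolys R d" using F by (simp add: bipolys_top_def)
    have "strip_tail R d H a = fst w" "strip_tail R d H b = snd w"
      unfolding H using g w F by (auto intro!: tail[OF Fb ab(1) F(2)] tail[OF Fb ab(2) F(3)])
    thus "H \<in> ?fib w" using \<phi>_top[OF F(1)] H by auto
  qed
  moreover have "inj_on \<phi> (?fib t)"
  proof (rule inj_onI)
    fix F H assume FH: "F \<in> ?fib t" "H \<in> ?fib t" and eq: "\<phi> F = \<phi> H"
    hence F: "F \<in> exponents d \<rightarrow>\<^sub>E carrier R" and H: "H \<in> exponents d \<rightarrow>\<^sub>E carrier R"
      by (auto simp: bipolys_top_def bipolys_def)
    show "F = H"
    proof (rule PiE_ext[OF F H])
      fix e assume e: "e \<in> exponents d"
      with fun_cong[OF eq, of e] have "F e \<oplus> D e = H e \<oplus> D e" by (simp add: \<phi>_def)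
      thus "F e = H e" using F H D e by (metis PiE_mem add.right_cancel)
    qed
  qed
  moreover have "finite (?fib w)"
    using finite_bipolys[OF fin] by (simp add: bipolys_top_def)
  ultimately show ?thesis by (intro card_inj_on_le[of \<phi>])
qed

text \<open>Given \<open>c\<close>, the pair of tails is uniform on all pairs; for the events
  \<open>P\<close> and \<open>Q\<close> this is independence of the two strips.\<close>

lemma card_strip_tails:
  assumes fin: "finite (carrier R)" and ab: "a \<in> carrier R" "b \<in> carrier R" "a \<noteq> b"
    and PQ: "P \<subseteq> random_choices R d" "Q \<subseteq> random_choices R d"
  shows "real (card {F \<in> bipolys_top R d c. strip_tail R d F a \<in> P \<and> strip_tail R d F b \<in> Q})
    = (card P / card (carrier R) ^ d) * (card Q / card (carrier R) ^ d) * card (bipolys_top R d c)"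
proof -
  let ?T = "random_choices R d \<times> random_choices R d"
  let ?S = "{F \<in> bipolys_top R d c. strip_tail R d F a \<in> P \<and> strip_tail R d F b \<in> Q}"
  have finB: "finite (bipolys_top R d c)"
    using finite_bipolys[OF fin] by (simp add: bipolys_top_def)
  have "card {F \<in> bipolys_top R d c. (strip_tail R d F a, strip_tail R d F b) \<in> P \<times> Q} * card ?T
      = card (bipolys_top R d c) * card (P \<times> Q)"
  proof (rule card_equidistributed[OF finB])
    show "finite ?T" using finite_random_choices[OF fin] by simp
    show "(strip_tail R d F a, strip_tail R d F b) \<in> ?T" if "F \<in> bipolys_top R d c" for F
      using that strip_tail_random_choices ab by (simp add: bipolys_top_def)
    show "P \<times> Q \<subseteq> ?T" using PQ by auto
  qed (rule card_strip_tails_le[OF fin ab])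
  hence "card ?S * (card (carrier R) ^ d * card (carrier R) ^ d) = card (bipolys_top R d c) * (card P * card Q)"
    by (simp add: card_cartesian_product card_random_choices[OF fin])
  hence "real (card ?S * (card (carrier R) ^ d * card (carrier R) ^ d))
      = real (card (bipolys_top R d c) * (card P * card Q))" by (simp only:)
  thus ?thesis using card_carrier_ge_2[OF fin] by (simp add: field_simps)
qed

section \<open>The mean of (q + 1) / (N + 1) over the polynomials\<close>

lemma sum_inverse_root_count_top:
  assumes fin: "finite (carrier R)" and c: "c \<in> carrier R" and d: "2 \<le> d"
  shows "(\<Sum>F\<in>bipolys_top R d c.
      (real (card (carrier R)) + 1) / (real (card {a\<in>carrier R. has_root R d F a}) + 1))
    \<le> card (bipolys_top R d c) * (1 / root_freq R c d + (1 - root_freq R c d) / root_freq R c d)"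
proof (rule pairwise_independent_sum_inverse_le)
  let ?B = "bipolys_top R d c" and ?p = "root_freq R c d"
  let ?P = "{ps \<in> random_choices R d. \<exists>x\<in>carrier R. eval (c # ps) x = \<zero>}"
  have p: "?p = card ?P / card (carrier R) ^ d" by (simp add: root_freq_def del: eval.simps)
  show finB: "finite ?B" using finite_bipolys[OF fin] by (simp add: bipolys_top_def)
  show "finite (carrier R)" by (rule fin)
  show "0 < ?p" using root_freq_ge_half[OF fin c d] by simp
  show "?p \<le> 1" by (rule root_freq_le_1[OF fin])
  \<comment> \<open>With the leading coefficient fixed as \<open>c\<close>, having a root is an
    event about the tail alone.\<close>
  have root: "has_root R d F a \<longleftrightarrow> strip_tail R d F a \<in> ?P" if "F \<in> ?B" "a \<in> carrier R" for F a
    using has_root_iff[of F d a] strip_tail_random_choices[of F d a] that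
    by (auto simp: bipolys_top_def simp del: eval.simps)
  have tail_P: "strip_tail R d F a \<in> random_choices R d" if "F \<in> ?B" "a \<in> carrier R" for F a
    using strip_tail_random_choices[of F d a] that by (simp add: bipolys_top_def)
  show "(\<Sum>F\<in>?B. of_bool (has_root R d F a) * of_bool (has_root R d F b)) = ?p\<^sup>2 * card ?B"
    if "a \<in> carrier R" "b \<in> carrier R" "a \<noteq> b" for a b
  proof -
    have "(\<Sum>F\<in>?B. of_bool (has_root R d F a) * of_bool (has_root R d F b))
        = real (card {F\<in>?B. strip_tail R d F a \<in> ?P \<and> strip_tail R d F b \<in> ?P})"
    proof -
      have "?B \<inter> {F. has_root R d F a \<and> has_root R d F b}
          = {F\<in>?B. strip_tail R d F a \<in> ?P \<and> strip_tail R d F b \<in> ?P}"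
        using root that by (auto simp del: eval.simps)
      thus ?thesis using finB by (simp add: sum_of_bool_eq flip: of_bool_conj del: eval.simps)
    qed
    also have "\<dots> = ?p\<^sup>2 * card ?B"
      unfolding p by (subst card_strip_tails[OF fin that]) (auto simp: power2_eq_square simp del: eval.simps)
    finally show ?thesis .
  qed
  show "(\<Sum>F\<in>?B. of_bool (has_root R d F a)) = ?p * card ?B" if a: "a \<in> carrier R" for a
  proof -
    \<comment> \<open>The law of a single strip is a marginal of the law of two: any other strip
      \<open>b\<close> serves, with no condition imposed on its tail.\<close>
    obtain b where b: "b \<in> carrier R" "a \<noteq> b"
      using zero_not_one by (cases "a = \<zero>") (metis one_closed, metis zero_closed)
    have "(\<Sum>F\<in>?B. of_bool (has_root R d F a))
        = real (card {F\<in>?B. strip_tail R d F a \<in> ?P \<and> strip_tail R d F b \<in> random_choices R d})"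
    proof -
      have "?B \<inter> {F. has_root R d F a}
          = {F\<in>?B. strip_tail R d F a \<in> ?P \<and> strip_tail R d F b \<in> random_choices R d}"
        using root a tail_P b by (auto simp del: eval.simps)
      thus ?thesis using finB by (simp add: sum_of_bool_eq del: eval.simps)
    qed
    also have "\<dots> = ?p * card ?B"
      unfolding p using card_carrier_ge_2[OF fin]
      by (subst card_strip_tails[OF fin a b])
         (auto simp: card_random_choices[OF fin] simp del: eval.simps)
    finally show ?thesis .
  qed
qed

lemma card_bipolys_top:
  assumes fin: "finite (carrier R)" and c: "c \<in> carrier R"
  shows "card (bipolys R d) = card (carrier R) * card (bipolys_top R d c)"
proof -
  have top: "(0, d) \<in> exponents d" by (simp add: exponents_def)
  have "bipolys_top R d c = (\<Pi>\<^sub>E e\<in>exponents d. if e = (0, d) then {c} else carrier R)"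
  proof (intro equalityI subsetI)
    fix F assume "F \<in> bipolys_top R d c"
    thus "F \<in> (\<Pi>\<^sub>E e\<in>exponents d. if e = (0, d) then {c} else carrier R)"
      by (simp add: bipolys_top_def bipolys_def PiE_iff)
  next
    fix F assume F: "F \<in> (\<Pi>\<^sub>E e\<in>exponents d. if e = (0, d) then {c} else carrier R)"
    have "F e \<in> carrier R" if "e \<in> exponents d" for e
      using PiE_mem[OF F that] c by (simp split: if_splits)
    moreover have "F (0, d) = c" using PiE_mem[OF F top] by simp
    ultimately show "F \<in> bipolys_top R d c"
      using F by (simp add: bipolys_top_def bipolys_def PiE_iff)
  qed
  hence "card (bipolys_top R d c) = (\<Prod>e\<in>exponents d. if e = (0, d) then 1 else card (carrier R))"
    by (simp add: card_PiE[OF finite_exponents] if_distrib cong: if_cong)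
  also have "\<dots> = card (carrier R) ^ card (exponents d - {(0, d)})"
    using finite_exponents[of d]
    by (subst prod.remove[of _ "(0, d)"]) (auto simp: exponents_def)
  finally have "card (bipolys_top R d c) = card (carrier R) ^ card (exponents d - {(0, d)})" .
  moreover have "card (exponents d) = Suc (card (exponents d - {(0, d)}))"
    using finite_exponents[of d] by (intro card.remove) (auto simp: exponents_def)
  ultimately show ?thesis
    by (simp add: bipolys_def card_PiE[OF finite_exponents])
qed

lemma sum_inverse_root_count:
  assumes fin: "finite (carrier R)" and d: "2 \<le> d"
  shows "(\<Sum>F\<in>bipolys R d.
      (real (card (carrier R)) + 1) / (real (card {a\<in>carrier R. has_root R d F a}) + 1))
    \<le> card (bipolys R d) * (1 / monic_root_freq (card (carrier R)) d
        + (1 - monic_root_freq (card (carrier R)) d) / monic_root_freq (card (carrier R)) d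
        + 3 / card (carrier R))"
proof -
  let ?q = "card (carrier R)"
  define h :: "real \<Rightarrow> real" where "h = (\<lambda>p. 1 / p + (1 - p) / p)"
  let ?f = "\<lambda>F. (real ?q + 1) / (real (card {a\<in>carrier R. has_root R d F a}) + 1)"
  define b where "b = card (bipolys R d) / ?q"
  have q: "?q \<ge> 2" by (rule card_carrier_ge_2[OF fin])
  have b: "real (card (bipolys_top R d c)) = b" if "c \<in> carrier R" for c
    using card_bipolys_top[OF fin that, of d] q by (simp add: b_def)
  have "b \<ge> 0" by (simp add: b_def)
  have h_nonneg: "h p \<ge> 0" if "1 / 2 \<le> p" "p \<le> 1" for p using that by (simp add: h_def)
  \<comment> \<open>The value 3 is attained at p = 1/2.\<close>
  have h_le: "h p \<le> 3" if "1 / 2 \<le> p" for p using that by (simp add: h_def field_simps)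
  let ?m = "monic_root_freq ?q d"
  have m: "1 / 2 \<le> ?m" "?m \<le> 1"
    using root_freq_nonzero[OF fin one_closed, of d] root_freq_ge_half[OF fin one_closed d]
      root_freq_le_1[OF fin, of \<one> d] by auto
  have "(\<Sum>F\<in>bipolys R d. ?f F) = (\<Sum>c\<in>carrier R. \<Sum>F\<in>bipolys_top R d c. ?f F)"
    unfolding bipolys_top_def
    by (rule sum.group[symmetric, OF finite_bipolys[OF fin] fin])
       (auto intro: bipolys_carrier)
  also have "\<dots> \<le> (\<Sum>c\<in>carrier R. b * h (root_freq R c d))"
    using sum_inverse_root_count_top[OF fin _ d] b by (intro sum_mono) (simp add: h_def)
  also have "\<dots> \<le> (\<Sum>c\<in>carrier R. b * (h ?m + (if c = \<zero> then 3 else 0)))"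
  proof (intro sum_mono mult_left_mono \<open>b \<ge> 0\<close>)
    fix c assume c: "c \<in> carrier R"
    show "h (root_freq R c d) \<le> h ?m + (if c = \<zero> then 3 else 0)"
    proof (cases "c = \<zero>")
      case True
      thus ?thesis using h_le[OF root_freq_ge_half[OF fin c d]] h_nonneg[OF m] by simp
    qed (simp add: root_freq_nonzero[OF fin c])
  qed
  also have "\<dots> = b * (?q * h ?m + 3)"
    using fin by (simp add: sum_distrib_left[symmetric] sum.distrib)
  also have "\<dots> = card (bipolys R d) * (h ?m + 3 / ?q)"
    using q by (simp add: b_def field_simps)
  finally show ?thesis by (simp add: h_def)
qed

lemma svs_cost_le:
  assumes fin: "finite (carrier R)" and G: "gcd_routine R d G"
    and F: "F \<in> bipolys R d" and \<omega>: "\<omega> \<in> random_choices R m" and as: "set as \<subseteq> carrier R"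
  shows "svs_cost R d G S as F \<omega>
    \<le> strip_cost R d m G S * search_length {a\<in>carrier R. has_root R d F a} as"
  using as
proof (induction as)
  case Nil
  thus ?case by (simp add: svs_cost_def)
next
  case (Cons a as)
  let ?A = "{a\<in>carrier R. has_root R d F a}" and ?\<tau> = "strip_cost R d m G S"
  obtain r c where rc: "strip_search R d G S F \<omega> a = (r, c)" by fastforce
  have a: "a \<in> carrier R" using Cons.prems by simp
  have IH: "snd (svs R d G S F \<omega> as) \<le> ?\<tau> * search_length ?A as"
    using Cons by (simp add: svs_cost_def)
  have "snd (strip_search R d G S F \<omega> a) \<le> ?\<tau>"
    unfolding strip_cost_def
    using fin finite_bipolys[OF fin, of d] finite_random_choices[OF fin, of m] a F \<omega>
    by (intro Max_ge finite_imageI) (auto intro!: image_eqI[of _ _ "(a, F, \<omega>)"])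
  hence c: "c \<le> ?\<tau>" using rc by simp
  show ?case
  proof (cases "has_root R d F a")
    case True
    then obtain x where "x \<in> carrier R" "eval (strip_poly R d F a) x = \<zero>"
      by (auto simp: has_root_def)
    with strip_gcd_neq_one_if_root[OF fin strip_poly_closed[OF F a]]
    have "run R G (gcd_input d F a) \<noteq> [\<one>]"
      using G F a by (simp add: gcd_routine_def)
    then obtain y where "r = Some y" using rc by (auto simp: strip_search_def Let_def)
    thus ?thesis using rc c True a by (simp add: svs_cost_def)
  next
    case False
    thus ?thesis using rc c IH
      by (cases r) (auto simp: svs_cost_def add_mono split: prod.splits)
  qed
qed

lemma strips_eq:
  assumes "finite (carrier R)"
  shows "strips R = permutations_of_set (carrier R)"
proof -
  have "set as = carrier R \<longleftrightarrow> set as \<subseteq> carrier R \<and> length as = card (carrier R)" if "distinct as" for as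
    using distinct_card[OF that] card_subset_eq[OF assms, of "set as"] by auto
  thus ?thesis unfolding strips_def permutations_of_set_def by blast
qed

lemma average_cost_le:
  assumes fin: "finite (carrier R)" and d: "2 \<le> d" and G: "gcd_routine R d G"
  shows "average_cost R d m G S \<le> strip_cost R d m G S *
    (1 / monic_root_freq (card (carrier R)) d
        + (1 - monic_root_freq (card (carrier R)) d) / monic_root_freq (card (carrier R)) d
        + 3 / card (carrier R))" (is "_ \<le> ?\<tau> * ?C")
proof -
  let ?q = "card (carrier R)"
  let ?A = "\<lambda>F. {a\<in>carrier R. has_root R d F a}"
  let ?W = "random_choices R m" and ?B = "bipolys R d" and ?P = "permutations_of_set (carrier R)"
  have q: "?q \<ge> 2" by (rule card_carrier_ge_2[OF fin])
  have W: "card ?W > 0" using card_random_choices[OF fin, of m] q by simp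
  have B: "card ?B > 0" using q by (simp add: bipolys_def card_PiE[OF finite_exponents])
  have "(\<Sum>(as, F, \<omega>) \<in> strips R \<times> ?B \<times> ?W. real (svs_cost R d G S as F \<omega>))
      \<le> (\<Sum>(as, F, \<omega>) \<in> ?P \<times> ?B \<times> ?W. ?\<tau> * real (search_length (?A F) as))"
    unfolding strips_eq[OF fin]
  proof (intro sum_mono, clarify)
    fix as F \<omega> assume "as \<in> ?P" "F \<in> ?B" "\<omega> \<in> ?W"
    from svs_cost_le[OF fin G this(2,3), of as S] permutations_of_setD(1)[OF this(1)]
    have "svs_cost R d G S as F \<omega> \<le> strip_cost R d m G S * search_length (?A F) as" by simp
    hence "real (svs_cost R d G S as F \<omega>) \<le> real (strip_cost R d m G S * search_length (?A F) as)"
      by (rule of_nat_mono)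
    thus "real (svs_cost R d G S as F \<omega>) \<le> ?\<tau> * real (search_length (?A F) as)" by simp
  qed
  also have "\<dots> = ?\<tau> * (card ?W * (\<Sum>F\<in>?B. \<Sum>as\<in>?P. real (search_length (?A F) as)))"
    by (subst sum.swap) (simp add: sum.cartesian_product[symmetric] sum_distrib_left mult_ac)
  also have "\<dots> \<le> ?\<tau> * (card ?W * (\<Sum>F\<in>?B. fact ?q * ((real ?q + 1) / (real (card (?A F)) + 1))))"
    using fin by (intro mult_left_mono sum_mono sum_search_length_le) auto
  also have "\<dots> = ?\<tau> * (card ?W * (fact ?q * (\<Sum>F\<in>?B. (real ?q + 1) / (real (card (?A F)) + 1))))"
    by (simp add: sum_distrib_left)
  also have "\<dots> \<le> ?\<tau> * (card ?W * (fact ?q * (card ?B * ?C)))"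
    using sum_inverse_root_count[OF fin d] by (intro mult_left_mono) auto
  finally have "(\<Sum>(as, F, \<omega>) \<in> strips R \<times> ?B \<times> ?W. real (svs_cost R d G S as F \<omega>))
      \<le> ?\<tau> * ?C * (fact ?q * card ?B * card ?W)" by (simp add: mult_ac)
  thus ?thesis using W B
    by (simp add: average_cost_def strips_eq[OF fin] fin pos_divide_le_eq)
qed

end

theorem theorem4p5:
  fixes K :: "nat \<Rightarrow> 'a ring" and G R :: "nat \<Rightarrow> 'a tree" and d m :: nat
    and s \<alpha> :: real
  assumes d: "d \<ge> 2"
    and K: "\<And>q. primepow q \<Longrightarrow> field (K q) \<and> finite (carrier (K q)) \<and> card (carrier (K q)) = q"
    and G: "\<And>q. primepow q \<Longrightarrow> gcd_routine (K q) d (G q)"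
    and R: "\<And>q. primepow q \<Longrightarrow> root_routine (K q) d m (R q)"
    and s: "s = real d / 2 + 1"
    and \<alpha>: "\<alpha> = 1 - 1 / sqrt s"
  shows "\<exists>g :: nat \<Rightarrow> real. g \<in> O(\<lambda>q. 1 / real q) \<and>
    (\<forall>q. primepow q \<longrightarrow>
      average_cost (K q) d m (G q) (R q) \<le>
        real (strip_cost (K q) d m (G q) (R q)) *
          (1 / \<alpha>\<^sup>2 * ((1 - mu d) / mu d + 1 / ((fact d)\<^sup>2 * (mu d)\<^sup>2))
           + 1 / mu d
           + (1 - mu d / sqrt s) powr (s + 1))
        + g q)"
proof -
  define C where "C = 1 / \<alpha>\<^sup>2 * ((1 - mu d) / mu d + 1 / ((fact d)\<^sup>2 * (mu d)\<^sup>2))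
    + 1 / mu d + (1 - mu d / sqrt s) powr (s + 1)"
  define D where "D = (\<lambda>q. 1 / monic_root_freq q d + (1 - monic_root_freq q d) / monic_root_freq q d
    + 3 / real q)"
  have mu: "1 / 2 \<le> mu d" "mu d \<le> 1"
  proof -
    have bounds: "1 / 2 \<le> monic_root_freq q d \<and> monic_root_freq q d \<le> 1" if "primepow q" for q
    proof -
      interpret field "K q" using K[OF that] by simp
      show ?thesis using K[OF that] root_freq_nonzero[OF _ one_closed, of d]
          root_freq_ge_half[OF _ one_closed d] root_freq_le_1[of "\<one>\<^bsub>K q\<^esub>" d] by simp
    qed
    have "strict_mono (\<lambda>n. 2 ^ Suc n :: nat)" by (rule strict_monoI) simp
    from LIMSEQ_subseq_LIMSEQ[OF monic_root_freq_tendsto this]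
    have "(\<lambda>n. monic_root_freq (2 ^ Suc n) d) \<longlonglongrightarrow> mu d" by (simp only: o_def)
    moreover have pp: "primepow (2 ^ Suc n :: nat)" for n
      unfolding primepow_def using two_is_prime_nat by (intro exI[of _ 2] exI[of _ "Suc n"]) auto
    ultimately show "1 / 2 \<le> mu d" "mu d \<le> 1"
      using bounds[OF pp] by (blast intro: LIMSEQ_le_const LIMSEQ_le_const2)+
  qed
  have "D \<longlonglongrightarrow> 1 / mu d + (1 - mu d) / mu d + 0"
    unfolding D_def using mu
    by (intro tendsto_intros monic_root_freq_tendsto lim_const_over_n) auto
  moreover have "1 / mu d + (1 - mu d) / mu d + 0 < C"
  proof -
    have "s \<ge> 2" using s d by simp
    hence "sqrt s > 1" by simp
    hence "0 < \<alpha>" "\<alpha> < 1" by (simp_all add: \<alpha>)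
    hence "1 \<le> 1 / \<alpha>\<^sup>2" by (simp add: power_le_one)
    moreover have "0 < 1 / ((fact d)\<^sup>2 * (mu d)\<^sup>2)" "0 \<le> (1 - mu d) / mu d" using mu by simp_all
    ultimately have "1 * ((1 - mu d) / mu d + 1 / ((fact d)\<^sup>2 * (mu d)\<^sup>2))
        \<le> 1 / \<alpha>\<^sup>2 * ((1 - mu d) / mu d + 1 / ((fact d)\<^sup>2 * (mu d)\<^sup>2))"
      by (intro mult_right_mono) auto
    moreover have "(1 - mu d) / mu d < 1 * ((1 - mu d) / mu d + 1 / ((fact d)\<^sup>2 * (mu d)\<^sup>2))"
      using \<open>0 < 1 / ((fact d)\<^sup>2 * (mu d)\<^sup>2)\<close> by (simp only: mult_1 less_add_same_cancel1)
    ultimately have less: "(1 - mu d) / mu d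
        < 1 / \<alpha>\<^sup>2 * ((1 - mu d) / mu d + 1 / ((fact d)\<^sup>2 * (mu d)\<^sup>2))"
      by (rule less_le_trans[rotated])
    have "(1 - mu d) / mu d + 0 < 1 / \<alpha>\<^sup>2 * ((1 - mu d) / mu d + 1 / ((fact d)\<^sup>2 * (mu d)\<^sup>2))
        + (1 - mu d / sqrt s) powr (s + 1)"
      by (rule add_less_le_mono[OF less powr_ge_zero])
    thus ?thesis unfolding C_def by (simp add: add_ac)
  qed
  ultimately have "eventually (\<lambda>q. D q < C) sequentially" by (rule order_tendstoD)
  then obtain q0 where q0: "\<And>q. q \<ge> q0 \<Longrightarrow> D q < C" by (auto simp: eventually_sequentially)
  define g where "g = (\<lambda>q. if q < q0
    then average_cost (K q) d m (G q) (R q) - real (strip_cost (K q) d m (G q) (R q)) * C else 0)"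
  have "eventually (\<lambda>q. g q = 0) sequentially"
    using eventually_ge_at_top[of q0] by eventually_elim (simp add: g_def)
  hence "g \<in> O(\<lambda>q. 1 / real q)"
    by (intro bigoI[of _ 0]) (auto elim: eventually_mono)
  moreover have "average_cost (K q) d m (G q) (R q) \<le> real (strip_cost (K q) d m (G q) (R q)) * C + g q"
    if "primepow q" for q
  proof (cases "q < q0")
    case False
    have "average_cost (K q) d m (G q) (R q) \<le> real (strip_cost (K q) d m (G q) (R q)) * D q"
      using field.average_cost_le[of "K q" d "G q" m "R q"] K[OF that] G[OF that] d
      by (simp add: D_def)
    also have "\<dots> \<le> real (strip_cost (K q) d m (G q) (R q)) * C"
      using q0[of q] False by (intro mult_left_mono) auto
    finally show ?thesis using False by (simp add: g_def)
  qed (simp add: g_def)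
  ultimately show ?thesis unfolding C_def by blast
qed

end
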